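(* Let $D$ be a locally closed subset of $\mathbb{R}^n$ and let $F:\overline{D}\rightrightarrows\mathbb{R}^n$ be a uniformly bounded multi-valued mapping with nonempty closed values. Assume that there exist a sequence of positive reals $\varepsilon_k$, $k=1,2,\dots$, tending to zero as $k\to\infty$, and relatively open and dense (in $D$) sets $D_k\subseteq D$, $k=1,2,\dots$, with $D_1=D$, such that $F$ is $\varepsilon_k$-lower semi-continuous on $D_k$ for each $k$, and that there exists a sequence of continuous functions $w_k:D\to\mathbb{R}$, $k=1,2,\dots$, such that: (i) $w_{k_1}\ge w_{k_2}$ on $D$ for every $k_1\le k_2$; (ii) for each positive integer $k$ we have $w_k(x)\ge 0$ for all $x\in D$, and $w_k(x)=0$ iff $x\notin D_k$; (iii) for each positive integer $k$ the restriction $w_k\!\restriction_{D_k}$ of $w_k$ to $D_k$ is a smooth function; (iv) for each positive integer $k$ and each $x\in D_k$ the set $F_k(x)$ is nonempty, where $F_0(x):=F(x)$ and, for each $k\ge 1$, $$F_k(x):=\{y\in F_{k-1}(x):\ \langle\mathbf{grad}\,w_k(x),y\rangle\ge 1\}.$$ Assume moreover that for each positive integer $k$ and each $x\in D_k$ the inclusion $F(x)\subseteq \left(T^B_D(x)\cap F_k(x)\right)+\varepsilon_k\overline{\mathbf{B}}$ holds. Then for each point $x_0\in D$ the differential inclusion $\dot{x}\in F(x)$ has a solution starting from $x_0$, i.e. there exist $T>0$ and an absolutely continuous function $x:[0,T]\to D$ with $x(0)=x_0$ and $\dot{x}(t)\in F(x(t))$ for almost every $t\in[0,T]$.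
   Context: $\overline{\mathbf{B}}$ is the closed unit ball of $\mathbb{R}^n$. A set is locally closed if it is the intersection of an open set and a closed set. $F$ is uniformly bounded if there is $c>0$ with $\|v\|\le c$ for all $x\in\overline{D}$, $v\in F(x)$. For $x\in D$, the Bouligand tangent cone is $T^B_D(x)=\{\lim_{n\to\infty}\frac{x_n-x}{t_n}: \{x_n\}\subseteq D,\ x_n\to x,\ t_n\searrow 0\}$. For $\varepsilon>0$, $F$ is $\varepsilon$-lower semi-continuous on a relatively open set $D'\subseteq D$ if for each $x\in D'$ and each $y\in F(x)$ there exists $\delta>0$ such that $F(x')\cap(y+\varepsilon\overline{\mathbf{B}})\neq\emptyset$ for every $x'\in D$ with $\|x'-x\|<\delta$. The restriction $w_k\!\restriction_{D_k}$ is called smooth if it is the restriction to $D_k$ of a smooth function defined on an open set of $\mathbb{R}^n$ containing $D_k$; $\mathbf{grad}\,w_k(x)$ for $x\in D_k$ denotes the gradient of this smooth function at $x$. (Conditions (i) and (ii) imply $D_{k+1}\subseteq D_k$, so $F_k(x)$ is well defined for $x\in D_k$.) *)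

theory Defs
  imports "HOL-Analysis.Analysis"
begin

definition locally_closed_set :: "'a::topological_space set \<Rightarrow> bool" where
  "locally_closed_set D \<longleftrightarrow> (\<exists>U C. open U \<and> closed C \<and> D = U \<inter> C)"

definition bouligand_cone :: "'a::real_normed_vector set \<Rightarrow> 'a \<Rightarrow> 'a set" where
  "bouligand_cone D x =
    {v. \<exists>(u :: nat \<Rightarrow> 'a) (t :: nat \<Rightarrow> real).
          (\<forall>n. u n \<in> D) \<and> u \<longlonglongrightarrow> x \<and>
          (\<forall>n. t n > 0) \<and> decseq t \<and> t \<longlonglongrightarrow> 0 \<and>
          (\<lambda>n. (u n - x) /\<^sub>R t n) \<longlonglongrightarrow> v}"

(* The multi-valued mapping F is a total set-valued function; here only its values
   on D are used. The neighbours x' range over D, not just over D'. *)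
definition eps_lsc_on ::
    "real \<Rightarrow> 'a::real_normed_vector set \<Rightarrow> ('a \<Rightarrow> 'b::real_normed_vector set) \<Rightarrow> 'a set \<Rightarrow> bool" where
  "eps_lsc_on \<epsilon> D F D' \<longleftrightarrow>
    (\<forall>x\<in>D'. \<forall>y\<in>F x. \<exists>\<delta>>0. \<forall>x'\<in>D. norm (x' - x) < \<delta> \<longrightarrow> F x' \<inter> cball y \<epsilon> \<noteq> {})"

(* C^m on an open set U: directional derivatives of all orders up to m exist in the
   Frechet sense and are continuous. Only meant for open U. *)
fun Cm_on :: "nat \<Rightarrow> 'a::euclidean_space set \<Rightarrow> ('a \<Rightarrow> real) \<Rightarrow> bool" where
  "Cm_on 0 U f \<longleftrightarrow> continuous_on U f"
| "Cm_on (Suc m) U f \<longleftrightarrow>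
     (\<forall>x\<in>U. f differentiable (at x)) \<and>
     (\<forall>v. Cm_on m U (\<lambda>x. frechet_derivative f (at x) v))"

definition smooth_on :: "'a::euclidean_space set \<Rightarrow> ('a \<Rightarrow> real) \<Rightarrow> bool" where
  "smooth_on U f \<longleftrightarrow> (\<forall>m. Cm_on m U f)"

definition grad :: "('a::euclidean_space \<Rightarrow> real) \<Rightarrow> 'a \<Rightarrow> 'a" where
  "grad f x = (THE d. GDERIV f x :> d)"

(* W k is the smooth extension of w_k restricted to D_k; since D_k need not be open in
   the ambient space, the gradient on D_k depends on the chosen extension. *)
fun Fk :: "('a::euclidean_space \<Rightarrow> 'a set) \<Rightarrow> (nat \<Rightarrow> 'a \<Rightarrow> real) \<Rightarrow> nat \<Rightarrow> 'a \<Rightarrow> 'a set" where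
  "Fk F W 0 x = F x"
| "Fk F W (Suc k) x = {y \<in> Fk F W k x. grad (W (Suc k)) x \<bullet> y \<ge> 1}"

definition absolutely_continuous_on_interval ::
    "real \<Rightarrow> real \<Rightarrow> (real \<Rightarrow> 'a::metric_space) \<Rightarrow> bool" where
  "absolutely_continuous_on_interval p q f \<longleftrightarrow>
    (\<forall>\<epsilon>>0. \<exists>\<delta>>0. \<forall>(n::nat) a b.
       (\<forall>i<n. p \<le> a i \<and> a i \<le> b i \<and> b i \<le> q) \<and>
       disjoint_family_on (\<lambda>i. {a i<..<b i}) {..<n} \<and>
       (\<Sum>i<n. b i - a i) < \<delta>
       \<longrightarrow> (\<Sum>i<n. dist (f (a i)) (f (b i))) < \<epsilon>)"

end

theory Submission
  imports Defs "HOL-Library.Bourbaki_Witt_Fixpoint" "HOL-Complex_Analysis.Great_Picard"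
begin

text \<open>
  After passing to a subsequence, \<open>\<epsilon>\<^sub>k \<le> 2\<^sup>-\<^sup>k\<close>. Space-time is cut into countably many cells, differences of
  forward cones \<open>\<bar>x - x\<^sub>p\<bar> < M (t - t\<^sub>p)\<close> whose slope \<open>M\<close> exceeds the speed of all trajectories, and one gets
  functions \<open>g\<^sub>k\<close>, constant on cells, with \<open>g\<^sub>k(t, x)\<close> within \<open>\<epsilon>\<^sub>k\<close> of \<open>F x\<close> for \<open>x \<in> D\<^sub>k\<close> and
  \<open>\<bar>g\<^sub>k\<^sub>+\<^sub>1 - g\<^sub>k\<bar> \<le> \<epsilon>\<^sub>k\<close>. A Lipschitz path of speed below \<open>M\<close> crosses cell boundaries at countably many times
  only. The tangency condition gives Euler approximations following \<open>g\<^sub>n\<close> up to \<open>O(\<epsilon>\<^sub>n)\<close>, started in \<open>D\<^sub>n\<close>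
  near \<open>x\<^sub>0\<close>; along them \<open>w\<^sub>n\<close> grows at rate at least 1/2. Since \<open>w\<^sub>k \<ge> w\<^sub>n\<close> for \<open>k \<le> n\<close>, a limit \<open>x\<close> satisfies
  \<open>w\<^sub>k(x(t)) \<ge> t/2\<close>, so \<open>x(t) \<in> D\<^sub>k\<close> for all \<open>k\<close> and \<open>t > 0\<close>. Outside a countable set of times every \<open>g\<^sub>k\<close> is
  constant near \<open>(t, x(t))\<close>, which forces \<open>x'(t) = lim\<^sub>k g\<^sub>k(t, x(t)) \<in> F(x(t))\<close>.
\<close>

section \<open>Piecewise constant approximate selections\<close>

text \<open>Constancy is asked on a whole space-time neighbourhood, since the approximations pass
  near the path and not along it. Time 0 is left out because a solution may start outside
  \<open>E\<close>.\<close>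

definition locally_constant_along :: "real \<Rightarrow> real \<Rightarrow> 'a::metric_space set \<Rightarrow> (real \<times> 'a \<Rightarrow> 'b) \<Rightarrow> bool" where
  "locally_constant_along L T E g \<longleftrightarrow>
    (\<forall>u. L-lipschitz_on {0..T} u \<and> u ` {0<..T} \<subseteq> E \<longrightarrow>
      countable {t\<in>{0<..T}. \<not> (\<forall>\<^sub>F p in nhds (t, u t). g p = g (t, u t))})"

lemma locally_constant_along_comp:
  assumes "locally_constant_along L T E g"
  shows "locally_constant_along L T E (\<lambda>p. y (g p))"
  unfolding locally_constant_along_def
proof (intro allI impI)
  fix u assume "L-lipschitz_on {0..T} u \<and> u ` {0<..T} \<subseteq> E"
  with assms have "countable {t\<in>{0<..T}. \<not> (\<forall>\<^sub>F p in nhds (t, u t). g p = g (t, u t))}"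
    unfolding locally_constant_along_def by blast
  then show "countable {t\<in>{0<..T}. \<not> (\<forall>\<^sub>F p in nhds (t, u t). y (g p) = y (g (t, u t)))}"
    by (rule countable_subset[rotated]) (clarsimp, erule notE, erule eventually_mono, simp)
qed

text \<open>For positive \<open>M\<close> and \<open>h p\<close> the apex lies \<open>h p\<close>
  before \<open>p\<close> in time, which makes \<open>p\<close> interior; cutting the cone off
  \<open>h p\<close> after \<open>p\<close> keeps its spatial radius below
  \<open>2 * M * h p\<close>.\<close>

definition forward_cone :: "real \<Rightarrow> (real \<times> 'a::metric_space \<Rightarrow> real) \<Rightarrow> real \<times> 'a \<Rightarrow> (real \<times> 'a) set" where
  "forward_cone M h p = {q. dist (snd q) (snd p) < M * (fst q - fst p + h p) \<and> fst q < fst p + h p}"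

lemma open_forward_cone: "open (forward_cone M h p)"
  unfolding forward_cone_def by (intro open_Collect_conj open_Collect_less continuous_intros)

text \<open>Along an \<open>L\<close>-Lipschitz path the height above the boundary of a cone of slope \<open>M > L\<close> is strictly
  increasing, so the path meets the lateral boundary at most once.\<close>
lemma countable_forward_cone_crossings:
  assumes "L-lipschitz_on I u" "L < M"
  shows "countable {t\<in>I. t = fst p + h p \<or> dist (u t) (snd p) = M * (t - fst p + h p)}"
proof -
  let ?A = "{t\<in>I. dist (u t) (snd p) = M * (t - fst p + h p)}"
  have False if "s \<in> ?A" "t \<in> ?A" "s < t" for s t
  proof -
    have "M * (t - s) = dist (u t) (snd p) - dist (u s) (snd p)"
      using that by (simp add: algebra_simps)
    also have "\<dots> \<le> dist (u t) (u s)"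
      using dist_triangle[of "u t" "snd p" "u s"] by simp
    also have "\<dots> \<le> L * (t - s)"
      using lipschitz_onD[OF assms(1), of t s] that by (simp add: dist_real_def)
    also have "\<dots> < M * (t - s)"
      using that \<open>L < M\<close> by simp
    finally show False by simp
  qed
  then have "s = t" if "s \<in> ?A" "t \<in> ?A" for s t
    using that by (meson linorder_neqE_linordered_idom)
  then have "?A \<subseteq> {SOME t. t \<in> ?A}"
    by (metis (no_types, lifting) singletonI someI_ex subsetI)
  then have "countable ?A" by (rule countable_subset) simp
  moreover have "{t\<in>I. t = fst p + h p \<or> dist (u t) (snd p) = M * (t - fst p + h p)} \<subseteq> ?A \<union> {fst p + h p}"
    by auto
  ultimately show ?thesis by (meson countable_Un countable_empty countable_insert countable_subset)
qed

text \<open>Off the two boundary equations one of the defining inequalities fails strictly, and that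
  is an open condition.\<close>

lemma eventually_not_in_forward_cone:
  assumes "q \<notin> forward_cone M h p" "fst q \<noteq> fst p + h p"
    "dist (snd q) (snd p) \<noteq> M * (fst q - fst p + h p)"
  shows "\<forall>\<^sub>F q' in nhds q. q' \<notin> forward_cone M h p"
proof -
  let ?O = "{q. M * (fst q - fst p + h p) < dist (snd q) (snd p)} \<union> {q. fst p + h p < fst q}"
  have "open ?O" by (intro open_Un open_Collect_less continuous_intros)
  moreover have "q \<in> ?O" using assms by (auto simp: forward_cone_def)
  ultimately have "\<forall>\<^sub>F q' in nhds q. q' \<in> ?O" by (rule eventually_nhds_in_open)
  then show ?thesis by (rule eventually_mono) (auto simp: forward_cone_def)
qed

text \<open>The map \<open>j\<close> sends a point to the apex data of the first cone containing it, in an enumerated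
  countable cover of the level set of \<open>g\<close> through that point.\<close>
lemma cone_decomposition:
  fixes g :: "real \<times> 'a::euclidean_space \<Rightarrow> 'b" and \<delta> :: "real \<times> 'a \<Rightarrow> real"
  assumes g_range: "countable (range g)" and g: "locally_constant_along L T E g"
    and "0 \<le> L" "E' \<subseteq> E" and \<delta>: "\<And>p. snd p \<in> E' \<Longrightarrow> \<delta> p > 0"
  obtains j :: "real \<times> 'a \<Rightarrow> real \<times> 'a" where
    "countable (range j)" "locally_constant_along L T E' j"
    "\<And>p. snd p \<in> E' \<Longrightarrow> snd (j p) \<in> E' \<and> g (j p) = g p \<and> dist (snd p) (snd (j p)) < \<delta> (j p)"
proof -
  define M where "M = L + 1"
  have "M > 0" "L < M" using \<open>0 \<le> L\<close> by (auto simp: M_def)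
  \<comment> \<open>With this height the spatial radius of the cone at \<open>p\<close> stays below
    \<open>2 * M * h p = \<delta> p\<close>.\<close>
  define h where "h p = \<delta> p / (2 * M)" for p
  let ?O = "forward_cone M h"
  define A where "A v = {p. snd p \<in> E' \<and> g p = v}" for v
  \<comment> \<open>Each level set of \<open>g\<close> is covered separately, so that
    \<open>j\<close> preserves the value of \<open>g\<close>. Countability of the cover serves both
    the range of \<open>j\<close> and the set of exceptional times.\<close>
  have "\<exists>B. B \<subseteq> A v \<and> countable B \<and> (\<Union>p\<in>B. ?O p) = (\<Union>p\<in>A v. ?O p)" for v
  proof -
    obtain \<F>' where F': "\<F>' \<subseteq> ?O ` A v" "countable \<F>'" "\<Union>\<F>' = \<Union>(?O ` A v)"
      using Lindelof[of "?O ` A v"] open_forward_cone by blast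
    then obtain B where "B \<subseteq> A v" "countable B" "\<F>' = ?O ` B"
      by (meson countable_subset_image)
    with F' show ?thesis by blast
  qed
  then obtain B where B: "\<And>v. B v \<subseteq> A v" "\<And>v. countable (B v)"
    "\<And>v. (\<Union>p\<in>B v. ?O p) = (\<Union>p\<in>A v. ?O p)" by metis
  define c where "c v = from_nat_into (B v)" for v
  define N where "N q = (LEAST n. q \<in> ?O (c (g q) n))" for q
  define j where "j q = c (g q) (N q)" for q
  have own: "p \<in> ?O p" if "snd p \<in> E'" for p
    using \<delta>[OF that] \<open>M > 0\<close> by (auto simp: forward_cone_def h_def)
  have covered: "\<exists>n. p \<in> ?O (c (g p) n)" and nonempty: "B (g p) \<noteq> {}" if "snd p \<in> E'" for p
  proof -
    have "p \<in> A (g p)" using that by (simp add: A_def)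
    then have "p \<in> (\<Union>p\<in>A (g p). ?O p)" using own[OF that] by blast
    then obtain b where b: "b \<in> B (g p)" "p \<in> ?O b" using B(3) by blast
    then show "B (g p) \<noteq> {}" by auto
    show "\<exists>n. p \<in> ?O (c (g p) n)"
      using b from_nat_into_surj[OF B(2) b(1)] unfolding c_def by metis
  qed
  have N: "p \<in> ?O (j p)" if "snd p \<in> E'" for p
    unfolding j_def N_def by (rule LeastI_ex[OF covered[OF that]])
  show thesis
  proof
    have "range j \<subseteq> (\<Union>v\<in>range g. range (c v))" by (auto simp: j_def)
    then show "countable (range j)"
      by (rule countable_subset) (intro countable_UN g_range, simp)
  next
    fix p :: "real \<times> 'a" assume p: "snd p \<in> E'"
    have "j p \<in> A (g p)"
      unfolding j_def c_def using from_nat_into[OF nonempty[OF p]] B(1) by blast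
    moreover have "dist (snd p) (snd (j p)) < \<delta> (j p)"
    proof -
      have *: "dist (snd p) (snd (j p)) < M * (fst p - fst (j p) + h (j p))" "fst p < fst (j p) + h (j p)"
        using N[OF p] by (auto simp: forward_cone_def)
      have "M * (fst p - fst (j p) + h (j p)) \<le> M * (2 * h (j p))"
        using *(2) \<open>M > 0\<close> by (intro mult_left_mono) auto
      also have "\<dots> = \<delta> (j p)" using \<open>M > 0\<close> by (simp add: h_def)
      finally show ?thesis using * by simp
    qed
    ultimately show "snd (j p) \<in> E' \<and> g (j p) = g p \<and> dist (snd p) (snd (j p)) < \<delta> (j p)"
      by (auto simp: A_def)
  next
    show "locally_constant_along L T E' j"
      unfolding locally_constant_along_def
    proof (intro allI impI)
      fix u assume u: "L-lipschitz_on {0..T} u \<and> u ` {0<..T} \<subseteq> E'"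
      \<comment> \<open>\<open>X p\<close> collects the times when the path meets the surfaces
        bounding the cone at \<open>p\<close>, and \<open>Y\<close> those when \<open>g\<close> is
        not locally constant.\<close>
      define X where "X p = {t\<in>{0..T}. t = fst p + h p \<or> dist (u t) (snd p) = M * (t - fst p + h p)}" for p
      define Y where "Y = {t\<in>{0<..T}. \<not> (\<forall>\<^sub>F p in nhds (t, u t). g p = g (t, u t))}"
      have "countable Y"
        using u g \<open>E' \<subseteq> E\<close> unfolding locally_constant_along_def Y_def by blast
      moreover have "countable (X p)" for p
        unfolding X_def using countable_forward_cone_crossings u \<open>L < M\<close> by blast
      ultimately have cnt: "countable (Y \<union> (\<Union>v\<in>range g. \<Union>n. X (c v n)))"
        by (intro countable_Un countable_UN g_range) auto
      have "\<forall>\<^sub>F p in nhds (t, u t). j p = j (t, u t)"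
        if t: "t \<in> {0<..T}" "t \<notin> Y \<union> (\<Union>v\<in>range g. \<Union>n. X (c v n))" for t
      proof -
        \<comment> \<open>The index \<open>N\<close> is constant near \<open>q\<close>: the cone of
          index \<open>N q\<close> is open, the finitely many earlier ones are avoided nearby
          because \<open>t\<close> is no crossing time, and constancy of \<open>g\<close> fixes the
          enumeration in use.\<close>
        define q where "q = (t, u t)"
        have gq: "\<forall>\<^sub>F p in nhds q. g p = g q" using t by (auto simp: Y_def q_def)
        have "snd q \<in> E'" using u t by (auto simp: q_def)
        then have "q \<in> ?O (c (g q) (N q))" using N unfolding j_def by blast
        then have in_O: "\<forall>\<^sub>F p in nhds q. p \<in> ?O (c (g q) (N q))"
          by (rule eventually_nhds_in_open[OF open_forward_cone])
        have "\<forall>\<^sub>F p in nhds q. p \<notin> ?O (c (g q) n)" if "n < N q" for n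
        proof (rule eventually_not_in_forward_cone)
          show "q \<notin> ?O (c (g q) n)" using that not_less_Least unfolding N_def by blast
          have "t \<notin> X (c (g q) n)" using t(2) by blast
          then show "fst q \<noteq> fst (c (g q) n) + h (c (g q) n)"
            "dist (snd q) (snd (c (g q) n)) \<noteq> M * (fst q - fst (c (g q) n) + h (c (g q) n))"
            using t(1) by (auto simp: X_def q_def)
        qed
        then have "\<forall>\<^sub>F p in nhds q. \<forall>n\<in>{..<N q}. p \<notin> ?O (c (g q) n)"
          by (intro eventually_ball_finite) auto
        then have "\<forall>\<^sub>F p in nhds q. j p = j q"
          using gq in_O
        proof eventually_elim
          case (elim p)
          have "N p = N q" unfolding N_def[of p] elim(2)
            by (rule Least_equality) (use elim in \<open>auto simp: not_less[symmetric]\<close>)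
          then show ?case by (simp add: j_def elim)
        qed
        then show ?thesis by (simp add: q_def)
      qed
      then have "{t\<in>{0<..T}. \<not> (\<forall>\<^sub>F p in nhds (t, u t). j p = j (t, u t))} \<subseteq> Y \<union> (\<Union>v\<in>range g. \<Union>n. X (c v n))"
        by blast
      then show "countable {t\<in>{0<..T}. \<not> (\<forall>\<^sub>F p in nhds (t, u t). j p = j (t, u t))}"
        using cnt by (rule countable_subset)
    qed
  qed
qed

section \<open>Refining selections over shrinking domains\<close>

text \<open>Each point gets a value of \<open>F\<close> near \<open>g\<close>, and lower
  semicontinuity keeps \<open>F\<close> within \<open>b\<close> of that value on a ball. Using the
  value at the representative \<open>j p\<close> throughout a cell gives local constancy, and
  closeness to \<open>g\<close> survives because \<open>j\<close> preserves
  \<open>g\<close>.\<close>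

lemma refine_selection:
  fixes g :: "real \<times> 'a::euclidean_space \<Rightarrow> 'a"
  assumes g: "countable (range g)" "locally_constant_along L T E g"
    and near: "\<And>p. snd p \<in> E' \<Longrightarrow> F (snd p) \<inter> cball (g p) a \<noteq> {}"
    and lsc: "eps_lsc_on b D F E'" and "E' \<subseteq> E" "E' \<subseteq> D" "0 \<le> L"
  obtains g' :: "real \<times> 'a \<Rightarrow> 'a" where
    "countable (range g')" "locally_constant_along L T E' g'"
    "\<And>p. snd p \<in> E' \<Longrightarrow> F (snd p) \<inter> cball (g' p) b \<noteq> {}"
    "\<And>p. snd p \<in> E' \<Longrightarrow> dist (g' p) (g p) \<le> a"
proof -
  define Y where "Y p = (SOME y. y \<in> F (snd p) \<inter> cball (g p) a)" for p
  have Y: "Y p \<in> F (snd p)" "dist (Y p) (g p) \<le> a" if "snd p \<in> E'" for p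
  proof -
    have "\<exists>y. y \<in> F (snd p) \<inter> cball (g p) a" using near[OF that] by blast
    then have "Y p \<in> F (snd p) \<inter> cball (g p) a"
      unfolding Y_def by (rule someI_ex)
    then show "Y p \<in> F (snd p)" "dist (Y p) (g p) \<le> a" by (auto simp: dist_commute)
  qed
  have ex: "\<exists>\<delta>>0. \<forall>x'\<in>D. norm (x' - snd p) < \<delta> \<longrightarrow> F x' \<inter> cball (Y p) b \<noteq> {}" if "snd p \<in> E'" for p
    using lsc Y(1)[OF that] that unfolding eps_lsc_on_def by blast
  define \<delta> where "\<delta> p = (SOME \<delta>. \<delta> > 0 \<and> (\<forall>x'\<in>D. norm (x' - snd p) < \<delta> \<longrightarrow> F x' \<inter> cball (Y p) b \<noteq> {}))" for p
  have \<delta>: "\<delta> p > 0 \<and> (\<forall>x'\<in>D. norm (x' - snd p) < \<delta> p \<longrightarrow> F x' \<inter> cball (Y p) b \<noteq> {})" if "snd p \<in> E'" for p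
    unfolding \<delta>_def by (rule someI_ex) (rule ex[OF that])
  obtain j where j: "countable (range j)" "locally_constant_along L T E' j"
    "\<And>p. snd p \<in> E' \<Longrightarrow> snd (j p) \<in> E' \<and> g (j p) = g p \<and> dist (snd p) (snd (j p)) < \<delta> (j p)"
    using cone_decomposition[OF g \<open>0 \<le> L\<close> \<open>E' \<subseteq> E\<close>, of \<delta>] \<delta> by blast
  show thesis
  proof (rule that[of "\<lambda>p. Y (j p)"])
    have "range (\<lambda>p. Y (j p)) = Y ` range j" by auto
    then show "countable (range (\<lambda>p. Y (j p)))" using j(1) by simp
    show "locally_constant_along L T E' (\<lambda>p. Y (j p))"
      by (rule locally_constant_along_comp[OF j(2)])
    \<comment> \<open>The radius is that of the representative \<open>j p\<close>: its ball contains
      \<open>snd p\<close>, so \<open>F (snd p)\<close> still meets the \<open>b\<close>-ball about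
      \<open>Y (j p)\<close>.\<close>
    show "F (snd p) \<inter> cball (Y (j p)) b \<noteq> {}" if "snd p \<in> E'" for p
      using \<delta>[of "j p"] j(3)[OF that] that \<open>E' \<subseteq> D\<close> by (auto simp: dist_norm)
    show "dist (Y (j p)) (g p) \<le> a" if "snd p \<in> E'" for p
      using Y(2)[of "j p"] j(3)[OF that] by simp
  qed
qed

text \<open>Dependent choice iterates \<open>refine_selection\<close>: the accuracy
  \<open>e i\<close> of one stage bounds the distance to the next.\<close>

lemma nested_selections:
  fixes D :: "'a::euclidean_space set"
  assumes bound: "\<And>x v. x \<in> D \<Longrightarrow> v \<in> F x \<Longrightarrow> norm v \<le> c"
    and ne: "\<And>x. x \<in> D \<Longrightarrow> F x \<noteq> {}"
    and E: "\<And>i. E i \<subseteq> D" "\<And>i. E (Suc i) \<subseteq> E i"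
    and lsc: "\<And>i. eps_lsc_on (e i) D F (E i)" and "0 \<le> L"
  obtains g :: "nat \<Rightarrow> real \<times> 'a \<Rightarrow> 'a" where
    "\<And>i. locally_constant_along L T (E i) (g i)"
    "\<And>i p. snd p \<in> E i \<Longrightarrow> F (snd p) \<inter> cball (g i p) (e i) \<noteq> {}"
    "\<And>i p. snd p \<in> E (Suc i) \<Longrightarrow> dist (g (Suc i) p) (g i p) \<le> e i"
proof -
  define P where "P i g \<longleftrightarrow> countable (range g) \<and> locally_constant_along L T (E i) g \<and>
    (\<forall>p. snd p \<in> E i \<longrightarrow> F (snd p) \<inter> cball (g p) (e i) \<noteq> {})"
    for i and g :: "real \<times> 'a \<Rightarrow> 'a"
  define Q where "Q i g g' \<longleftrightarrow> (\<forall>p. snd p \<in> E (Suc i) \<longrightarrow> dist (g' p) (g p) \<le> e i)"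
    for i and g g' :: "real \<times> 'a \<Rightarrow> 'a"
  have base: "\<exists>g. P 0 g"
  proof -
    \<comment> \<open>The constant 0 acts as the stage before the first: the bound on
      \<open>F\<close> makes it accurate up to \<open>c\<close>.\<close>
    have 1: "locally_constant_along L T D (\<lambda>p. 0::'a)" by (simp add: locally_constant_along_def)
    have 2: "F (snd p) \<inter> cball 0 c \<noteq> {}" if "snd p \<in> E 0" for p :: "real \<times> 'a"
    proof -
      have "snd p \<in> D" using that E(1) by blast
      with ne obtain v where "v \<in> F (snd p)" by blast
      with bound[OF \<open>snd p \<in> D\<close>] have "v \<in> F (snd p) \<inter> cball 0 c" by simp
      then show ?thesis by blast
    qed
    have 3: "countable (range (\<lambda>p::real \<times> 'a. 0::'a))" by simp
    obtain g' where "countable (range g')" "locally_constant_along L T (E 0) g'"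
      "\<And>p. snd p \<in> E 0 \<Longrightarrow> F (snd p) \<inter> cball (g' p) (e 0) \<noteq> {}"
      "\<And>p. snd p \<in> E 0 \<Longrightarrow> dist (g' p) 0 \<le> c"
      using refine_selection[OF 3 1 2 lsc[of 0] E(1)[of 0] E(1)[of 0] \<open>0 \<le> L\<close>] by blast
    then have "P 0 g'" by (simp add: P_def)
    then show ?thesis by blast
  qed
  have step: "\<exists>g'. P (Suc i) g' \<and> Q i g g'" if "P i g" for g i
  proof -
    have 1: "F (snd p) \<inter> cball (g p) (e i) \<noteq> {}" if "snd p \<in> E (Suc i)" for p
      using \<open>P i g\<close> that E(2) unfolding P_def by blast
    have 2: "countable (range g)" "locally_constant_along L T (E i) g" using that by (auto simp: P_def)
    obtain g' where "countable (range g')" "locally_constant_along L T (E (Suc i)) g'"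
      "\<And>p. snd p \<in> E (Suc i) \<Longrightarrow> F (snd p) \<inter> cball (g' p) (e (Suc i)) \<noteq> {}"
      "\<And>p. snd p \<in> E (Suc i) \<Longrightarrow> dist (g' p) (g p) \<le> e i"
      using refine_selection[OF 2 1 lsc[of "Suc i"] E(2)[of i] E(1)[of "Suc i"] \<open>0 \<le> L\<close>] by blast
    then have "P (Suc i) g'" "Q i g g'" by (simp_all add: P_def Q_def)
    then show ?thesis by blast
  qed
  obtain g where "\<And>i. P i (g i)" "\<And>i. Q i (g i) (g (Suc i))"
    using dependent_nat_choice[of P Q, OF base step] by blast
  then show thesis unfolding P_def Q_def by (intro that[of g]) blast+
qed

lemma dist_selections:
  assumes e: "\<And>i. e i \<le> (1 / 2) ^ i"
    and E: "\<And>i. E (Suc i) \<subseteq> E i"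
    and g: "\<And>i p. snd p \<in> E (Suc i) \<Longrightarrow> dist (g (Suc i) p) (g i p) \<le> e i"
    and "k \<le> i" "snd p \<in> E i"
  shows "dist (g i p) (g k p) \<le> 2 * (1 / 2) ^ k"
proof -
  \<comment> \<open>Subtracting the tail leaves the exact geometric partial sum, so the induction
    closes.\<close>
  have "dist (g i p) (g k p) \<le> 2 * (1 / 2) ^ k - 2 * (1 / 2) ^ i"
    using \<open>k \<le> i\<close> \<open>snd p \<in> E i\<close>
  proof (induction i rule: dec_induct)
    case base
    then show ?case by simp
  next
    case (step i)
    then have "dist (g i p) (g k p) \<le> 2 * (1 / 2) ^ k - 2 * (1 / 2) ^ i" using E by blast
    moreover have "dist (g (Suc i) p) (g i p) \<le> (1 / 2) ^ i" using g[OF step.prems] e[of i] by linarith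
    ultimately show ?case using dist_triangle[of "g (Suc i) p" "g k p" "g i p"] by simp
  qed
  moreover have "(0::real) \<le> 2 * (1 / 2) ^ i" by simp
  ultimately show ?thesis by linarith
qed

section \<open>Euler approximations\<close>

text \<open>Step sizes have no positive lower bound, so the Euler scheme is iterated transfinitely: the
  iterates of \<open>f\<close> form a chain in the compact set \<open>S\<close>, ordered by reachability at speed \<open>L\<close>.\<close>
lemma transfinite_euler:
  fixes S :: "(real \<times> 'a::real_normed_vector) set" and f :: "real \<times> 'a \<Rightarrow> real \<times> 'a"
  assumes "compact S" "a \<in> S" "\<eta> > 0"
    and f_in: "\<And>p. p \<in> S \<Longrightarrow> f p \<in> S"
    and f_time: "\<And>p. p \<in> S \<Longrightarrow> fst p \<le> fst (f p) \<and> fst (f p) \<le> fst p + \<eta>"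
    and f_lip: "\<And>p. p \<in> S \<Longrightarrow> dist (snd p) (snd (f p)) \<le> L * (fst (f p) - fst p)"
    and f_strict: "\<And>p. p \<in> S \<Longrightarrow> fst p \<noteq> T \<Longrightarrow> fst p < fst (f p)"
  obtains G where "a \<in> G" "G \<subseteq> S"
    "\<And>p q. p \<in> G \<Longrightarrow> q \<in> G \<Longrightarrow> dist (snd p) (snd q) \<le> L * \<bar>fst p - fst q\<bar>"
    "\<And>t. fst a \<le> t \<Longrightarrow> t \<le> T \<Longrightarrow> \<exists>p\<in>G. \<bar>fst p - t\<bar> \<le> \<eta>"
    "\<And>p q v \<rho>. p \<in> G \<Longrightarrow> q \<in> G \<Longrightarrow> fst p \<le> fst q \<Longrightarrow>
       (\<And>m. m \<in> G \<Longrightarrow> fst p \<le> fst m \<Longrightarrow> fst m < fst q \<Longrightarrow>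
          norm (snd (f m) - snd m - (fst (f m) - fst m) *\<^sub>R v) \<le> \<rho> * (fst (f m) - fst m)) \<Longrightarrow>
       norm (snd q - snd p - (fst q - fst p) *\<^sub>R v) \<le> \<rho> * (fst q - fst p)"
proof -
  \<comment> \<open>Two points at equal times are related only if they coincide, which gives
    antisymmetry.\<close>
  define R where "R = {(p, q). p \<in> S \<and> q \<in> S \<and> fst p \<le> fst q \<and> dist (snd p) (snd q) \<le> L * (fst q - fst p)}"
  have R_refl: "(p, p) \<in> R" if "p \<in> S" for p
    using that by (simp add: R_def)
  have Field: "Field R = S"
    using R_refl by (auto intro: FieldI1) (auto simp: Field_def R_def)
  have R_trans: "(p, r) \<in> R" if "(p, q) \<in> R" "(q, r) \<in> R" for p q r
  proof -
    have "dist (snd p) (snd r) \<le> dist (snd p) (snd q) + dist (snd q) (snd r)"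
      by (rule dist_triangle)
    also have "\<dots> \<le> L * (fst q - fst p) + L * (fst r - fst q)"
      using that unfolding R_def by auto
    finally show ?thesis
      using that unfolding R_def by (auto simp: algebra_simps)
  qed
  have R_antisym: "p = q" if "(p, q) \<in> R" "(q, p) \<in> R" for p q
    using that unfolding R_def by (auto simp: prod_eq_iff)
  have up_closed: "closed {q. fst p \<le> fst q \<and> dist (snd p) (snd q) \<le> L * (fst q - fst p)}" for p
    by (intro closed_Collect_conj closed_Collect_le continuous_intros)
  have down_closed: "closed {p. fst p \<le> fst q \<and> dist (snd p) (snd q) \<le> L * (fst q - fst p)}" for q
    by (intro closed_Collect_conj closed_Collect_le continuous_intros)
  have clS: "closure M \<subseteq> S" if "M \<subseteq> S" for M
    using that \<open>compact S\<close> by (simp add: closure_minimal compact_imp_closed)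
  \<comment> \<open>This supplies the finite intersection property for the compactness argument in
    \<open>upper_ex\<close>.\<close>
  have chain_fin: "\<exists>q\<in>M. \<forall>p\<in>A. (p, q) \<in> R" if "M \<in> Chains R" "finite A" "A \<subseteq> M" "M \<noteq> {}" for M A
    using \<open>finite A\<close> \<open>A \<subseteq> M\<close>
  proof (induction A)
    case empty
    then show ?case using \<open>M \<noteq> {}\<close> by auto
  next
    case (insert p A)
    then obtain q where q: "q \<in> M" "\<forall>p\<in>A. (p, q) \<in> R" by auto
    have "p \<in> M" using insert by auto
    with that(1) q have "(p, q) \<in> R \<or> (q, p) \<in> R" by (auto simp: Chains_def)
    then show ?case
    proof
      assume "(p, q) \<in> R" then show ?thesis using q by auto
    next
      assume *: "(q, p) \<in> R"
      then have "p \<in> S" by (auto simp: R_def)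
      then show ?thesis using q * \<open>p \<in> M\<close> R_trans R_refl by blast
    qed
  qed
  have chain_sub: "M \<subseteq> S" if "M \<in> Chains R" for M
    using Chains_FieldD[OF that] Field by auto
  have upper_ex: "\<exists>q. q \<in> closure M \<and> (\<forall>p\<in>M. (p, q) \<in> R)" if M: "M \<in> Chains R" "M \<noteq> {}" for M
  proof -
    let ?C = "\<lambda>p. {q. fst p \<le> fst q \<and> dist (snd p) (snd q) \<le> L * (fst q - fst p)}"
    have MS: "M \<subseteq> S" by (rule chain_sub[OF M(1)])
    have "compact (closure M)"
      using clS[OF MS] \<open>compact S\<close> by (metis closed_closure compact_Int_closed inf.absorb_iff2)
    have "closure M \<inter> (\<Inter>p\<in>M. ?C p) \<noteq> {}"
    proof (rule compact_imp_fip_image[OF \<open>compact (closure M)\<close>])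
      fix I assume "finite I" "I \<subseteq> M"
      with chain_fin M obtain q where "q \<in> M" "\<forall>p\<in>I. (p, q) \<in> R" by blast
      then show "closure M \<inter> (\<Inter>p\<in>I. ?C p) \<noteq> {}"
        using closure_subset[of M] by (auto simp: R_def)
    qed (rule up_closed)
    then obtain q where "q \<in> closure M" "\<forall>p\<in>M. q \<in> ?C p" by blast
    moreover from this have "(p, q) \<in> R" if "p \<in> M" for p
      using that MS clS[OF MS] unfolding R_def by auto
    ultimately show ?thesis by blast
  qed
  \<comment> \<open>An upper bound in the closure of a chain is automatically least, since the set
    of points below a given one is closed.\<close>
  define lub where "lub M = (SOME q. q \<in> closure M \<and> (\<forall>p\<in>M. (p, q) \<in> R))" for M
  have lub: "lub M \<in> closure M" "\<And>p. p \<in> M \<Longrightarrow> (p, lub M) \<in> R" if "M \<in> Chains R" "M \<noteq> {}" for M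
    using someI_ex[OF upper_ex[OF that]] unfolding lub_def by blast+
  interpret bw: bourbaki_witt_fixpoint lub R f
  proof
    show "Partial_order R"
      unfolding partial_order_on_def preorder_on_def Field
      using R_refl R_trans R_antisym by (auto simp: refl_on_def trans_def antisym_def R_def)
  next
    fix M z assume M: "M \<in> Chains R" "M \<noteq> {}" and z: "\<And>x. x \<in> M \<Longrightarrow> (x, z) \<in> R"
    have "closure M \<subseteq> {p. fst p \<le> fst z \<and> dist (snd p) (snd z) \<le> L * (fst z - fst p)}"
      by (rule closure_minimal[OF _ down_closed]) (use z in \<open>auto simp: R_def\<close>)
    then show "(lub M, z) \<in> R"
      using lub(1)[OF M] clS[OF chain_sub[OF M(1)]] z M(2) by (auto simp: R_def)
  next
    fix M x assume "M \<in> Chains R" "x \<in> M"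
    then show "(x, lub M) \<in> R" using lub by blast
  next
    fix M assume "M \<in> Chains R" "M \<noteq> {}"
    then show "lub M \<in> Field R" using lub Field clS chain_sub by blast
  next
    fix x assume "x \<in> Field R"
    then show "(x, f x) \<in> R" using Field f_in f_time f_lip by (auto simp: R_def)
  qed
  have aF: "a \<in> Field R" using \<open>a \<in> S\<close> Field by simp
  define G where "G = bw.iterates_above a"
  have GS: "G \<subseteq> S" using bw.iterates_above_Field[OF _ aF] Field by (auto simp: G_def)
  have G_chain: "(p, q) \<in> R \<or> (q, p) \<in> R" if "p \<in> G" "q \<in> G" for p q
    using bw.chain_iterates_above[OF aF] that by (auto simp: G_def Chains_def)
  \<comment> \<open>A time \<open>t\<close> is either passed by an earlier iterate or lies in the
    last stretch: a successor step is at most \<open>\<eta>\<close> long, and a supremum has chain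
    members within \<open>\<eta>\<close>.\<close>
  have mesh: "\<exists>p\<in>G. \<bar>fst p - t\<bar> \<le> \<eta>" if "q \<in> bw.iterates_above a" "fst a \<le> t" "t \<le> fst q" for q t
    using that
  proof (induction arbitrary: t rule: bw.iterates_above.induct)
    case base
    then show ?case using \<open>\<eta> > 0\<close> by (intro bexI[of _ a]) (auto simp: G_def bw.iterates_above.base)
  next
    case (step x)
    show ?case
    proof (cases "t \<le> fst x")
      case True
      then show ?thesis using step by auto
    next
      case False
      have "x \<in> G" using step by (simp add: G_def)
      moreover have "\<bar>fst x - t\<bar> \<le> \<eta>" using False step.prems f_time[of x] \<open>x \<in> G\<close> GS by auto
      ultimately show ?thesis by blast
    qed
  next
    case (Sup M)
    obtain m where m: "m \<in> M" "dist m (lub M) < \<eta>"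
      using lub(1)[OF Sup(1,2)] \<open>\<eta> > 0\<close> by (meson closure_approachable)
    show ?case
    proof (cases "t \<le> fst m")
      case True
      then show ?thesis using Sup m by auto
    next
      case False
      have "m \<in> G" using Sup m by (simp add: G_def)
      moreover have "dist (fst m) (fst (lub M)) < \<eta>"
        using m(2) dist_fst_le[of m "lub M"] by simp
      then have "\<bar>fst m - t\<bar> \<le> \<eta>" using False Sup.prems by (auto simp: dist_real_def)
      ultimately show ?thesis by blast
    qed
  qed
  \<comment> \<open>Successor steps add their errors; at suprema the estimate persists because it is
    a closed condition.\<close>
  have incr: "norm (snd q - snd p - (fst q - fst p) *\<^sub>R v) \<le> \<rho> * (fst q - fst p)"
    if "q \<in> bw.iterates_above p" "p \<in> G"
       "\<And>m. m \<in> G \<Longrightarrow> fst p \<le> fst m \<Longrightarrow> fst m < fst q \<Longrightarrow>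
          norm (snd (f m) - snd m - (fst (f m) - fst m) *\<^sub>R v) \<le> \<rho> * (fst (f m) - fst m)"
     for p q v \<rho>
    using that
  proof (induction rule: bw.iterates_above.induct)
    case base
    then show ?case by simp
  next
    case (step x)
    have pF: "p \<in> Field R" using step.prems GS Field by auto
    have px: "(p, x) \<in> R" using bw.iterates_above_ge[OF step(1) pF] .
    have xS: "x \<in> S" using px by (auto simp: R_def)
    have xle: "fst x \<le> fst (f x)" using f_time xS by auto
    show ?case
    proof (cases "f x = x")
      case True
      then show ?thesis using step by auto
    next
      case False
      \<comment> \<open>A step that moves must advance in time, because \<open>f_lip\<close> freezes
        the position at equal times. Hence \<open>x\<close> strictly precedes the end point and the
        hypothesis on \<open>m\<close> applies to it.\<close>
      have "fst x < fst (f x)"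
      proof (rule ccontr)
        assume "\<not> fst x < fst (f x)"
        with xle have "fst x = fst (f x)" by simp
        with f_lip[OF xS] have "f x = x" by (auto simp: prod_eq_iff)
        with False show False ..
      qed
      moreover have "x \<in> G"
      proof -
        have "x \<in> G \<or> x \<in> bw.iterates_above p" using step by blast
        moreover have "bw.iterates_above p \<subseteq> G"
        proof
          fix y assume "y \<in> bw.iterates_above p"
          then show "y \<in> G" using \<open>p \<in> G\<close> unfolding G_def
            by (induction rule: bw.iterates_above.induct) (auto intro: bw.iterates_above.intros)
        qed
        ultimately show ?thesis by blast
      qed
      moreover have "fst p \<le> fst x" using px by (auto simp: R_def)
      ultimately have 1: "norm (snd (f x) - snd x - (fst (f x) - fst x) *\<^sub>R v) \<le> \<rho> * (fst (f x) - fst x)"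
        using step.prems by blast
      have 2: "norm (snd x - snd p - (fst x - fst p) *\<^sub>R v) \<le> \<rho> * (fst x - fst p)"
        using step xle by force
      have "snd (f x) - snd p - (fst (f x) - fst p) *\<^sub>R v =
        (snd (f x) - snd x - (fst (f x) - fst x) *\<^sub>R v) + (snd x - snd p - (fst x - fst p) *\<^sub>R v)"
        by (simp add: algebra_simps)
      then have "norm (snd (f x) - snd p - (fst (f x) - fst p) *\<^sub>R v) \<le>
        \<rho> * (fst (f x) - fst x) + \<rho> * (fst x - fst p)"
        using norm_triangle_mono[OF 1 2] by (simp only:)
      then show ?thesis by (simp add: algebra_simps)
    qed
  next
    case (Sup M)
    let ?C = "{q. norm (snd q - snd p - (fst q - fst p) *\<^sub>R v) \<le> \<rho> * (fst q - fst p)}"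
    have "m \<in> ?C" if "m \<in> M" for m
    proof -
      have "fst m \<le> fst (lub M)" using lub(2)[OF Sup(1,2) that] by (simp add: R_def)
      then show ?thesis using Sup.IH[OF that \<open>p \<in> G\<close>] Sup.prems(2) by force
    qed
    then have "closure M \<subseteq> ?C"
      by (intro closure_minimal closed_Collect_le continuous_intros) auto
    then show ?case using lub(1)[OF Sup(1,2)] by blast
  qed
  show thesis
  proof
    show "a \<in> G" by (simp add: G_def bw.iterates_above.base)
    show "G \<subseteq> S" by (rule GS)
    show "dist (snd p) (snd q) \<le> L * \<bar>fst p - fst q\<bar>" if "p \<in> G" "q \<in> G" for p q
      using G_chain[OF that] by (auto simp: R_def dist_commute)
    show "\<exists>p\<in>G. \<bar>fst p - t\<bar> \<le> \<eta>" if "fst a \<le> t" "t \<le> T" for t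
    proof -
      let ?e = "bw.fixp_above a"
      have e: "?e \<in> bw.iterates_above a" by (rule bw.fixp_iterates_above)
      have "f ?e = ?e" using bw.fixp_above_unfold[OF aF] by simp
      \<comment> \<open>By \<open>f_strict\<close> a fixed point can only sit at time
        \<open>T\<close>, so the iterates span the whole time interval.\<close>
      then have "fst ?e = T" using f_strict[of ?e] GS e by (force simp: G_def)
      then show ?thesis using mesh[OF e] that by simp
    qed
    show "norm (snd q - snd p - (fst q - fst p) *\<^sub>R v) \<le> \<rho> * (fst q - fst p)"
      if "p \<in> G" "q \<in> G" "fst p \<le> fst q"
       "\<And>m. m \<in> G \<Longrightarrow> fst p \<le> fst m \<Longrightarrow> fst m < fst q \<Longrightarrow>
          norm (snd (f m) - snd m - (fst (f m) - fst m) *\<^sub>R v) \<le> \<rho> * (fst (f m) - fst m)"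
      for p q v \<rho>
    proof -
      \<comment> \<open>Of two iterates one is always an iterate above the other; the order contrary
        to time forces them to be equal.\<close>
      have "p \<in> bw.iterates_above q \<or> q \<in> bw.iterates_above p"
        using bw.iterates_above_triangle[OF _ _ aF] that by (auto simp: G_def)
      then show ?thesis
      proof
        assume "q \<in> bw.iterates_above p"
        then show ?thesis using incr that by blast
      next
        assume "p \<in> bw.iterates_above q"
        then have "(q, p) \<in> R" using bw.iterates_above_ge that GS Field by blast
        then have "p = q" using that(3) by (auto simp: R_def prod_eq_iff)
        then show ?thesis by simp
      qed
    qed
  qed
qed

text \<open>Applies \<open>transfinite_euler\<close> to states obeying a growth bound on
  \<open>w\<close> and a distance bound from \<open>a\<close>. The first keeps them in
  \<open>E\<close>, where further steps exist; the second keeps them in the ball. Both are closed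
  conditions, so the state space is compact.\<close>

lemma euler_graph:
  fixes D :: "'a::euclidean_space set" and g :: "real \<times> 'a \<Rightarrow> 'a"
  assumes K: "compact (D \<inter> cball x0 R)" and "0 \<le> c" "0 \<le> T" "0 < \<eta>" "\<eta> \<le> 1"
    and w: "continuous_on D w" and pos: "\<And>x. x \<in> D \<Longrightarrow> x \<in> E \<longleftrightarrow> w x > 0"
    and a: "a \<in> E" "a \<in> D" "dist x0 a + (c + 1) * T \<le> R"
    and g: "\<And>p. snd p \<in> E \<Longrightarrow> F (snd p) \<inter> cball (g p) e \<noteq> {}"
    and step: "\<And>x y \<eta>. x \<in> E \<Longrightarrow> y \<in> F x \<Longrightarrow> \<eta> > 0 \<Longrightarrow>
      \<exists>s z. 0 < s \<and> s \<le> \<eta> \<and> z \<in> D \<and> norm (z - x) \<le> (c + \<eta>) * s \<and>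
        norm (z - x - s *\<^sub>R y) \<le> (e + \<eta>) * s \<and> w z \<ge> w x + s / 2"
  obtains G where "(0, a) \<in> G" "G \<subseteq> {0..T} \<times> (D \<inter> cball x0 R)"
    "\<And>p. p \<in> G \<Longrightarrow> w (snd p) > fst p / 2"
    "\<And>p q. p \<in> G \<Longrightarrow> q \<in> G \<Longrightarrow> dist (snd p) (snd q) \<le> (c + 1) * \<bar>fst p - fst q\<bar>"
    "\<And>t. t \<in> {0..T} \<Longrightarrow> \<exists>p\<in>G. \<bar>fst p - t\<bar> \<le> \<eta>"
    "\<And>p q v \<rho>. p \<in> G \<Longrightarrow> q \<in> G \<Longrightarrow> fst p \<le> fst q \<Longrightarrow>
       (\<And>m. m \<in> G \<Longrightarrow> fst p \<le> fst m \<Longrightarrow> fst m < fst q \<Longrightarrow> dist (g m) v \<le> \<rho>) \<Longrightarrow>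
       norm (snd q - snd p - (fst q - fst p) *\<^sub>R v) \<le> (\<rho> + 2 * e + \<eta>) * (fst q - fst p)"
proof -
  let ?K = "D \<inter> cball x0 R"
  \<comment> \<open>The extra 1 absorbs the velocity error of a step, which is at most
    \<open>\<eta> \<le> 1\<close>.\<close>
  define L where "L = c + 1"
  have "L \<ge> 0" using \<open>0 \<le> c\<close> by (simp add: L_def)
  define S where "S = {p \<in> {0..T} \<times> ?K. w a + fst p / 2 \<le> w (snd p)} \<inter> {p. dist a (snd p) \<le> L * fst p}"
  have S: "p \<in> S \<longleftrightarrow> fst p \<in> {0..T} \<and> snd p \<in> ?K \<and> w a + fst p / 2 \<le> w (snd p) \<and> dist a (snd p) \<le> L * fst p" for p
    by (auto simp: S_def mem_Times_iff)
  have "closed {p \<in> {0..T} \<times> ?K. w a + fst p / 2 \<le> w (snd p)}"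
  proof (rule continuous_on_closed_Collect_le)
    show "continuous_on ({0..T} \<times> ?K) (\<lambda>p. w (snd p))"
      by (rule continuous_on_compose2[OF w]) (auto intro: continuous_intros)
    show "closed ({0..T} \<times> ?K)" using K by (intro closed_Times compact_imp_closed) auto
  qed (intro continuous_intros; simp)
  moreover have "closed {p::real \<times> 'a. dist a (snd p) \<le> L * fst p}"
    by (intro closed_Collect_le continuous_intros)
  ultimately have "closed S" unfolding S_def by (rule closed_Int)
  moreover have "S \<subseteq> {0..T} \<times> ?K" by (auto simp: S_def)
  moreover have "compact ({0..T} \<times> ?K)" using K by (intro compact_Times) auto
  ultimately have "compact S" by (metis compact_Int_closed inf.absorb_iff2)
  have "w a > 0" using a pos by blast
  have aS: "(0, a) \<in> S"
    using a \<open>0 \<le> T\<close> \<open>L \<ge> 0\<close> by (auto simp: S L_def) (smt (verit) mult_nonneg_nonneg)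
  \<comment> \<open>One \<open>e\<close> comes from the step following some \<open>y\<close> in
    \<open>F\<close>, the other from the distance between \<open>y\<close> and
    \<open>g p\<close>.\<close>
  define good where "good p q \<longleftrightarrow> q \<in> S \<and> fst p < fst q \<and> fst q \<le> fst p + \<eta> \<and>
    dist (snd p) (snd q) \<le> L * (fst q - fst p) \<and>
    norm (snd q - snd p - (fst q - fst p) *\<^sub>R g p) \<le> (2 * e + \<eta>) * (fst q - fst p)" for p q
  have good_ex: "\<exists>q. good p q" if p: "p \<in> S" "fst p \<noteq> T" for p
  proof -
    obtain t x where tx: "p = (t, x)" by (cases p)
    have t: "0 \<le> t" "t < T" and x: "x \<in> D" "w a + t / 2 \<le> w x" "dist a x \<le> L * t"
      using p by (auto simp: S tx)
    have "x \<in> E" using x t \<open>w a > 0\<close> pos by auto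
    then obtain y where y: "y \<in> F x" "dist (g p) y \<le> e" using g[of p] by (auto simp: tx)
    \<comment> \<open>Capping at the remaining time prevents overshooting \<open>T\<close>.\<close>
    define \<eta>' where "\<eta>' = min \<eta> (T - t)"
    have \<eta>': "\<eta>' > 0" "\<eta>' \<le> \<eta>" "\<eta>' \<le> T - t" using t \<open>0 < \<eta>\<close> by (auto simp: \<eta>'_def)
    obtain s z where s: "0 < s" "s \<le> \<eta>'" and z: "z \<in> D" "norm (z - x) \<le> (c + \<eta>') * s"
        "norm (z - x - s *\<^sub>R y) \<le> (e + \<eta>') * s" "w z \<ge> w x + s / 2"
      using step[OF \<open>x \<in> E\<close> y(1) \<eta>'(1)] by blast
    have "(c + \<eta>') * s \<le> L * s" using s \<eta>' \<open>\<eta> \<le> 1\<close> by (intro mult_right_mono) (auto simp: L_def)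
    then have zx: "dist x z \<le> L * s" using z(2) by (simp add: dist_norm norm_minus_commute)
    have az: "dist a z \<le> L * (t + s)"
      using dist_triangle[of a z x] x(3) zx by (simp add: algebra_simps)
    also have "\<dots> \<le> L * T" using s \<eta>' \<open>L \<ge> 0\<close> by (intro mult_left_mono) auto
    finally have "dist x0 z \<le> R"
      using dist_triangle[of x0 z a] a(3) by (simp add: L_def)
    moreover have "w a + (t + s) / 2 \<le> w z" using z(4) x(2) by (simp add: add_divide_distrib)
    ultimately have "(t + s, z) \<in> S" using z(1) s \<eta>' t az by (simp add: S)
    moreover have "norm (z - x - s *\<^sub>R g p) \<le> (2 * e + \<eta>) * s"
    proof -
      have "z - x - s *\<^sub>R g p = (z - x - s *\<^sub>R y) + s *\<^sub>R (y - g p)" by (simp add: algebra_simps)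
      then have "norm (z - x - s *\<^sub>R g p) \<le> norm (z - x - s *\<^sub>R y) + norm (s *\<^sub>R (y - g p))"
        by (metis norm_triangle_ineq)
      also have "norm (s *\<^sub>R (y - g p)) \<le> s * e"
        using s y(2) by (simp add: dist_norm norm_minus_commute)
      also have "norm (z - x - s *\<^sub>R y) \<le> (e + \<eta>) * s"
        using z(3) mult_right_mono[of "e + \<eta>'" "e + \<eta>" s] \<eta>'(2) s(1) by linarith
      finally show ?thesis by (simp add: algebra_simps)
    qed
    ultimately have "good p (t + s, z)"
      using s \<eta>' zx by (simp add: good_def tx)
    then show ?thesis by blast
  qed
  \<comment> \<open>Final states stay fixed, so that \<open>f\<close> maps all of \<open>S\<close>
    into itself.\<close>
  define f where "f p = (if fst p = T then p else SOME q. good p q)" for p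
  have f: "good p (f p)" if "p \<in> S" "fst p \<noteq> T" for p
    using someI_ex[OF good_ex[OF that]] that by (simp add: f_def)
  have f_T: "f p = p" if "fst p = T" for p using that by (simp add: f_def)
  have good_f: "f p \<in> S \<and> fst p \<le> fst (f p) \<and> fst (f p) \<le> fst p + \<eta> \<and>
      dist (snd p) (snd (f p)) \<le> L * (fst (f p) - fst p)" if "p \<in> S" for p
    using f[OF that] f_T[of p] that \<open>0 < \<eta>\<close> unfolding good_def by (cases "fst p = T") auto
  obtain G where G: "(0, a) \<in> G" "G \<subseteq> S"
    "\<And>p q. p \<in> G \<Longrightarrow> q \<in> G \<Longrightarrow> dist (snd p) (snd q) \<le> L * \<bar>fst p - fst q\<bar>"
    "\<And>t. 0 \<le> t \<Longrightarrow> t \<le> T \<Longrightarrow> \<exists>p\<in>G. \<bar>fst p - t\<bar> \<le> \<eta>"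
    "\<And>p q v \<rho>. p \<in> G \<Longrightarrow> q \<in> G \<Longrightarrow> fst p \<le> fst q \<Longrightarrow>
       (\<And>m. m \<in> G \<Longrightarrow> fst p \<le> fst m \<Longrightarrow> fst m < fst q \<Longrightarrow>
          norm (snd (f m) - snd m - (fst (f m) - fst m) *\<^sub>R v) \<le> \<rho> * (fst (f m) - fst m)) \<Longrightarrow>
       norm (snd q - snd p - (fst q - fst p) *\<^sub>R v) \<le> \<rho> * (fst q - fst p)"
  proof (rule transfinite_euler[OF \<open>compact S\<close> aS \<open>0 < \<eta>\<close>, of f L T])
    show "fst p < fst (f p)" if "p \<in> S" "fst p \<noteq> T" for p
      using f[OF that] by (simp add: good_def)
  qed (use good_f in \<open>auto\<close>)
  show thesis
  proof
    show "(0, a) \<in> G" by fact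
    show "G \<subseteq> {0..T} \<times> ?K" using G(2) \<open>S \<subseteq> _\<close> by blast
    show "w (snd p) > fst p / 2" if "p \<in> G" for p
      using that G(2) \<open>w a > 0\<close> S[of p] by auto
    show "dist (snd p) (snd q) \<le> (c + 1) * \<bar>fst p - fst q\<bar>" if "p \<in> G" "q \<in> G" for p q
      using G(3)[OF that] by (simp add: L_def)
    show "\<exists>p\<in>G. \<bar>fst p - t\<bar> \<le> \<eta>" if "t \<in> {0..T}" for t
      using G(4) that by simp
    fix p q v \<rho>
    assume pq: "p \<in> G" "q \<in> G" "fst p \<le> fst q"
      and m: "\<And>m. m \<in> G \<Longrightarrow> fst p \<le> fst m \<Longrightarrow> fst m < fst q \<Longrightarrow> dist (g m) v \<le> \<rho>"
    show "norm (snd q - snd p - (fst q - fst p) *\<^sub>R v) \<le> (\<rho> + 2 * e + \<eta>) * (fst q - fst p)"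
    proof (rule G(5)[OF pq])
      fix m assume m': "m \<in> G" "fst p \<le> fst m" "fst m < fst q"
      define s where "s = fst (f m) - fst m"
      have "q \<in> S" "m \<in> S" using pq m' G(2) by auto
      \<comment> \<open>A node before \<open>q\<close> lies before \<open>T\<close>, so
        \<open>f m\<close> is a genuine step.\<close>
      then have "fst m \<noteq> T" using m' S[of q] by auto
      then have "good m (f m)" using f \<open>m \<in> S\<close> by blast
      then have s: "s > 0" "norm (snd (f m) - snd m - s *\<^sub>R g m) \<le> (2 * e + \<eta>) * s"
        by (auto simp: good_def s_def)
      have "snd (f m) - snd m - s *\<^sub>R v = (snd (f m) - snd m - s *\<^sub>R g m) + s *\<^sub>R (g m - v)"
        by (simp add: algebra_simps)
      then have "norm (snd (f m) - snd m - s *\<^sub>R v) \<le> norm (snd (f m) - snd m - s *\<^sub>R g m) + norm (s *\<^sub>R (g m - v))"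
        by (metis norm_triangle_ineq)
      also have "norm (s *\<^sub>R (g m - v)) \<le> s * \<rho>"
        using m[OF m'] s(1) by (simp add: dist_norm)
      finally show "norm (snd (f m) - snd m - (fst (f m) - fst m) *\<^sub>R v) \<le>
          (\<rho> + 2 * e + \<eta>) * (fst (f m) - fst m)"
        using s(2) unfolding s_def[symmetric] by (simp add: algebra_simps)
    qed
  qed
qed

section \<open>Compactness of approximate graphs\<close>

text \<open>An Arzela-Ascoli argument for graphs instead of functions: sampled positions are
  Lipschitz up to an error that vanishes with the mesh, so convergence on a countable dense set of
  times spreads to all times.\<close>

lemma approximate_graphs_limit:
  fixes G :: "nat \<Rightarrow> (real \<times> 'a::euclidean_space) set"
  assumes "bounded K" "0 \<le> L"
    and G: "\<And>i. G i \<subseteq> {0..T} \<times> K"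
    and lip: "\<And>i p q. p \<in> G i \<Longrightarrow> q \<in> G i \<Longrightarrow> dist (snd p) (snd q) \<le> L * \<bar>fst p - fst q\<bar>"
    and mesh: "\<And>i t. t \<in> {0..T} \<Longrightarrow> \<exists>p\<in>G i. \<bar>fst p - t\<bar> \<le> 1 / real (Suc i)"
  obtains \<kappa> x where "strict_mono (\<kappa> :: nat \<Rightarrow> nat)" "L-lipschitz_on {0..T} x"
    "\<And>t. t \<in> {0..T} \<Longrightarrow> \<exists>p. (\<forall>i. p i \<in> G (\<kappa> i)) \<and> p \<longlonglongrightarrow> (t, x t)"
proof -
  define P where "P i t = (SOME p. p \<in> G i \<and> \<bar>fst p - t\<bar> \<le> 1 / real (Suc i))" for i t
  have P: "P i t \<in> G i" "\<bar>fst (P i t) - t\<bar> \<le> 1 / real (Suc i)" if "t \<in> {0..T}" for i t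
    using someI_ex[OF mesh[OF that, of i, unfolded Bex_def]] unfolding P_def by blast+
  define X where "X i t = snd (P i t)" for i t
  obtain B where B: "\<And>z. z \<in> K \<Longrightarrow> norm z \<le> B"
    using \<open>bounded K\<close> by (auto simp: bounded_iff)
  obtain S where S: "countable S" "S \<subseteq> {0..T}" "{0..T} \<subseteq> closure S"
    using separable by blast
  have bound: "norm (X i t) \<le> B" if "t \<in> S" for i t
  proof -
    have "P i t \<in> {0..T} \<times> K" using P(1)[of t i] that S(2) G[of i] by blast
    then show ?thesis using B by (auto simp: X_def mem_Times_iff)
  qed
  obtain \<kappa> where \<kappa>: "strict_mono (\<kappa> :: nat \<Rightarrow> nat)" "\<And>t. t \<in> S \<Longrightarrow> \<exists>l. (\<lambda>i. X (\<kappa> i) t) \<longlonglongrightarrow> l"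
    using function_convergent_subsequence[of S X B] S(1) bound by blast
  define r where "r i = 1 / real (Suc (\<kappa> i))" for i
  have r: "r \<longlonglongrightarrow> 0"
    unfolding r_def using LIMSEQ_subseq_LIMSEQ[OF LIMSEQ_Suc[OF lim_1_over_n] \<kappa>(1)] by (simp add: o_def)
  have X_lip: "dist (X (\<kappa> i) s) (X (\<kappa> i) t) \<le> L * (\<bar>s - t\<bar> + 2 * r i)" if "s \<in> {0..T}" "t \<in> {0..T}" for i s t
  proof -
    have "dist (X (\<kappa> i) s) (X (\<kappa> i) t) \<le> L * \<bar>fst (P (\<kappa> i) s) - fst (P (\<kappa> i) t)\<bar>"
      unfolding X_def using lip P(1) that by blast
    also have "\<dots> \<le> L * (\<bar>s - t\<bar> + 2 * r i)"
      using P(2)[of s "\<kappa> i"] P(2)[of t "\<kappa> i"] that \<open>0 \<le> L\<close>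
      by (intro mult_left_mono) (auto simp: r_def)
    finally show ?thesis .
  qed
  have Cauchy: "Cauchy (\<lambda>i. X (\<kappa> i) t)" if t: "t \<in> {0..T}" for t
  proof (rule metric_CauchyI)
    fix e :: real assume "e > 0"
    \<comment> \<open>The length \<open>3 * \<delta>\<close> covers the distance from
      \<open>s\<close> to \<open>t\<close> and two mesh errors; at speed \<open>L\<close> this costs
      less than one third of \<open>e\<close>.\<close>
    define \<delta> where "\<delta> = e / (9 * (L + 1))"
    have "\<delta> > 0" using \<open>e > 0\<close> \<open>0 \<le> L\<close> by (simp add: \<delta>_def)
    have L\<delta>: "L * (3 * \<delta>) < e / 3"
      using \<open>e > 0\<close> \<open>0 \<le> L\<close> by (simp add: \<delta>_def field_simps)
    obtain s where s: "s \<in> S" "dist s t < \<delta>"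
      using t S(3) \<open>\<delta> > 0\<close> by (meson closure_approachable subsetD)
    have "Cauchy (\<lambda>i. X (\<kappa> i) s)" using \<kappa>(2)[OF s(1)] LIMSEQ_imp_Cauchy by blast
    then obtain N1 where N1: "\<And>i j. i \<ge> N1 \<Longrightarrow> j \<ge> N1 \<Longrightarrow> dist (X (\<kappa> i) s) (X (\<kappa> j) s) < e / 3"
      using metric_CauchyD[of _ "e / 3"] \<open>e > 0\<close> by force
    obtain N2 where N2: "\<And>i. i \<ge> N2 \<Longrightarrow> r i < \<delta>"
      using order_tendstoD(2)[OF r \<open>\<delta> > 0\<close>] by (auto simp: eventually_sequentially)
    have near: "dist (X (\<kappa> i) s) (X (\<kappa> i) t) < e / 3" if "i \<ge> N2" for i
    proof -
      have "dist (X (\<kappa> i) s) (X (\<kappa> i) t) \<le> L * (\<bar>s - t\<bar> + 2 * r i)"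
        using X_lip s S t by blast
      also have "\<dots> \<le> L * (3 * \<delta>)"
        using s(2) N2[OF that] \<open>0 \<le> L\<close> by (intro mult_left_mono) (auto simp: dist_real_def)
      finally show ?thesis using L\<delta> by linarith
    qed
    show "\<exists>M. \<forall>m\<ge>M. \<forall>n\<ge>M. dist (X (\<kappa> m) t) (X (\<kappa> n) t) < e"
    proof (intro exI allI impI)
      fix m n assume mn: "max N1 N2 \<le> m" "max N1 N2 \<le> n"
      have "dist (X (\<kappa> m) t) (X (\<kappa> n) t) \<le>
        dist (X (\<kappa> m) s) (X (\<kappa> m) t) + (dist (X (\<kappa> m) s) (X (\<kappa> n) s) + dist (X (\<kappa> n) s) (X (\<kappa> n) t))"
        by metric
      also have "\<dots> < e / 3 + (e / 3 + e / 3)"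
        using mn by (intro add_strict_mono near N1) auto
      finally show "dist (X (\<kappa> m) t) (X (\<kappa> n) t) < e" by simp
    qed
  qed
  define x where "x t = lim (\<lambda>i. X (\<kappa> i) t)" for t
  have x: "(\<lambda>i. X (\<kappa> i) t) \<longlonglongrightarrow> x t" if "t \<in> {0..T}" for t
    using Cauchy[OF that] unfolding x_def by (simp add: Cauchy_convergent convergent_LIMSEQ_iff[symmetric])
  show thesis
  proof
    show "strict_mono \<kappa>" by (rule \<kappa>)
    show "L-lipschitz_on {0..T} x"
    proof (rule lipschitz_onI)
      fix s t assume st: "s \<in> {0..T}" "t \<in> {0..T}"
      have "(\<lambda>i. dist (X (\<kappa> i) s) (X (\<kappa> i) t)) \<longlonglongrightarrow> dist (x s) (x t)"
        by (intro tendsto_dist x st)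
      moreover have "(\<lambda>i. L * (\<bar>s - t\<bar> + 2 * r i)) \<longlonglongrightarrow> L * (\<bar>s - t\<bar> + 2 * 0)"
        by (intro tendsto_intros r)
      ultimately have "dist (x s) (x t) \<le> L * (\<bar>s - t\<bar> + 2 * 0)"
        by (rule LIMSEQ_le) (use X_lip st in blast)
      then show "dist (x s) (x t) \<le> L * dist s t" by (simp add: dist_real_def)
    qed (rule \<open>0 \<le> L\<close>)
    show "\<exists>p. (\<forall>i. p i \<in> G (\<kappa> i)) \<and> p \<longlonglongrightarrow> (t, x t)" if t: "t \<in> {0..T}" for t
    proof (intro exI conjI allI)
      show "P (\<kappa> i) t \<in> G (\<kappa> i)" for i by (rule P(1)[OF t])
      have "(\<lambda>i. fst (P (\<kappa> i) t) - t) \<longlonglongrightarrow> 0"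
        by (rule Lim_null_comparison[OF _ r]) (use P(2)[OF t] in \<open>auto simp: r_def\<close>)
      then have "(\<lambda>i. fst (P (\<kappa> i) t)) \<longlonglongrightarrow> t" by (simp add: LIM_zero_iff)
      then have "(\<lambda>i. (fst (P (\<kappa> i) t), X (\<kappa> i) t)) \<longlonglongrightarrow> (t, x t)"
        by (intro tendsto_Pair x t)
      then show "(\<lambda>i. P (\<kappa> i) t) \<longlonglongrightarrow> (t, x t)" by (simp add: X_def)
    qed
  qed
qed

section \<open>Solutions of the differential inclusion\<close>

text \<open>For a suitable single \<open>k\<close> both \<open>r k\<close> and the distance from
  \<open>v k\<close> to \<open>V\<close> are below \<open>e / 2\<close>; the two halves make up the
  error allowed by the derivative.\<close>

lemma has_vector_derivative_from_estimates:
  fixes x :: "real \<Rightarrow> 'a::real_normed_vector"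
  assumes est: "\<And>k::nat. \<exists>\<eta>>0. \<forall>a\<in>I. \<forall>b\<in>I. a < b \<longrightarrow> \<bar>a - t\<bar> < \<eta> \<longrightarrow> \<bar>b - t\<bar> < \<eta> \<longrightarrow>
      norm (x b - x a - (b - a) *\<^sub>R v k) \<le> r k * (b - a)"
    and "t \<in> I" and r: "r \<longlonglongrightarrow> 0" and v: "v \<longlonglongrightarrow> V"
  shows "(x has_vector_derivative V) (at t within I)"
  unfolding has_vector_derivative_def has_derivative_within_alt
proof (intro conjI allI impI)
  show "bounded_linear (\<lambda>h. h *\<^sub>R V)" by (rule bounded_linear_scaleR_left)
  fix e :: real assume "e > 0"
  then have "\<forall>\<^sub>F k in sequentially. r k < e / 2 \<and> dist (v k) V < e / 2"
    by (intro eventually_conj order_tendstoD(2)[OF r] tendstoD[OF v]) auto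
  then obtain k where k: "r k < e / 2" "dist (v k) V < e / 2"
    using eventually_happens by force
  obtain \<eta> where "\<eta> > 0" and \<eta>: "\<And>a b. a \<in> I \<Longrightarrow> b \<in> I \<Longrightarrow> a < b \<Longrightarrow> \<bar>a - t\<bar> < \<eta> \<Longrightarrow> \<bar>b - t\<bar> < \<eta> \<Longrightarrow>
      norm (x b - x a - (b - a) *\<^sub>R v k) \<le> r k * (b - a)"
    using est by blast
  have est_V: "norm (x b - x a - (b - a) *\<^sub>R V) \<le> e * (b - a)"
    if "a \<in> I" "b \<in> I" "a < b" "\<bar>a - t\<bar> < \<eta>" "\<bar>b - t\<bar> < \<eta>" for a b
  proof -
    have "x b - x a - (b - a) *\<^sub>R V = (x b - x a - (b - a) *\<^sub>R v k) + (b - a) *\<^sub>R (v k - V)"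
      by (simp add: algebra_simps)
    then have "norm (x b - x a - (b - a) *\<^sub>R V) \<le> norm (x b - x a - (b - a) *\<^sub>R v k) + norm ((b - a) *\<^sub>R (v k - V))"
      by (metis norm_triangle_ineq)
    also have "norm (x b - x a - (b - a) *\<^sub>R v k) \<le> e / 2 * (b - a)"
      using \<eta>[OF that] k(1) that(3) by (smt (verit) mult_right_mono)
    also have "norm ((b - a) *\<^sub>R (v k - V)) \<le> e / 2 * (b - a)"
      using k(2) that(3) by (simp add: dist_norm mult.commute)
    finally show ?thesis by (simp add: algebra_simps)
  qed
  show "\<exists>d>0. \<forall>y\<in>I. norm (y - t) < d \<longrightarrow> norm (x y - x t - (y - t) *\<^sub>R V) \<le> e * norm (y - t)"
  proof (intro exI conjI ballI impI)
    show "\<eta> > 0" by fact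
    fix y assume y: "y \<in> I" "norm (y - t) < \<eta>"
    consider "y = t" | "y < t" | "t < y" by linarith
    then show "norm (x y - x t - (y - t) *\<^sub>R V) \<le> e * norm (y - t)"
    proof cases
      case 2
      have "x y - x t - (y - t) *\<^sub>R V = - (x t - x y - (t - y) *\<^sub>R V)" by (simp add: algebra_simps)
      then have "norm (x y - x t - (y - t) *\<^sub>R V) = norm (x t - x y - (t - y) *\<^sub>R V)"
        by (metis norm_minus_cancel)
      then show ?thesis using est_V[of y t] 2 y \<open>t \<in> I\<close> \<open>\<eta> > 0\<close> by simp
    next
      case 3
      then show ?thesis using est_V[of t y] y \<open>t \<in> I\<close> \<open>\<eta> > 0\<close> by simp
    qed simp
  qed
qed

lemma dist_prod_le: "dist p q \<le> dist (fst p) (fst q) + dist (snd p) (snd q)"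
  unfolding dist_prod_def by (rule sqrt_sum_squares_le_sum) simp_all

lemma AE_lebesgue_on_interval:
  assumes "countable N" "\<And>t. 0 < t \<Longrightarrow> t < T \<Longrightarrow> t \<notin> N \<Longrightarrow> P t"
  shows "AE t in lebesgue_on {0..T::real}. P t"
proof -
  \<comment> \<open>\<open>P\<close> is assumed at interior times only, so the end points join the
    null set.\<close>
  have "N \<union> {0, T} \<in> null_sets lebesgue"
    using assms(1) by (intro null_sets_completionI countable_imp_null_set_lborel) auto
  then have "AE t in lebesgue. t \<notin> N \<union> {0, T}" by (rule AE_not_in)
  then have "AE t in lebesgue. t \<in> {0..T} \<longrightarrow> P t"
    by (rule AE_mp) (use assms(2) in force)
  then show ?thesis by (simp add: AE_restrict_space_iff)
qed

lemma lipschitz_on_imp_absolutely_continuous: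
  assumes "L-lipschitz_on {p..q} f"
  shows "absolutely_continuous_on_interval p q f"
  unfolding absolutely_continuous_on_interval_def
proof (intro allI impI)
  fix e :: real assume "e > 0"
  have "0 \<le> L" by (rule lipschitz_on_nonneg[OF assms])
  show "\<exists>\<delta>>0. \<forall>(n::nat) a b. (\<forall>i<n. p \<le> a i \<and> a i \<le> b i \<and> b i \<le> q) \<and>
       disjoint_family_on (\<lambda>i. {a i<..<b i}) {..<n} \<and> (\<Sum>i<n. b i - a i) < \<delta>
       \<longrightarrow> (\<Sum>i<n. dist (f (a i)) (f (b i))) < e"
  proof (intro exI conjI allI impI)
    show "e / (L + 1) > 0" using \<open>e > 0\<close> \<open>0 \<le> L\<close> by simp
    fix n :: nat and a b :: "nat \<Rightarrow> real"
    assume *: "(\<forall>i<n. p \<le> a i \<and> a i \<le> b i \<and> b i \<le> q) \<and>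
       disjoint_family_on (\<lambda>i. {a i<..<b i}) {..<n} \<and> (\<Sum>i<n. b i - a i) < e / (L + 1)"
    have nonneg: "(\<Sum>i<n. b i - a i) \<ge> 0" using * by (intro sum_nonneg) auto
    have "dist (f (a i)) (f (b i)) \<le> L * (b i - a i)" if "i < n" for i
      using lipschitz_onD[OF assms, of "a i" "b i"] * that by (force simp: dist_real_def)
    then have "(\<Sum>i<n. dist (f (a i)) (f (b i))) \<le> (\<Sum>i<n. L * (b i - a i))"
      by (intro sum_mono) auto
    also have "\<dots> = L * (\<Sum>i<n. b i - a i)" by (simp add: sum_distrib_left)
    also have "\<dots> \<le> (L + 1) * (\<Sum>i<n. b i - a i)" using nonneg by (intro mult_right_mono) auto
    also have "\<dots> < e" using * \<open>0 \<le> L\<close> by (simp add: field_simps)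
    finally show "(\<Sum>i<n. dist (f (a i)) (f (b i))) < e" .
  qed
qed

text \<open>The situation after thinning the sequence: the errors are dominated by a geometric
  series, \<open>pos\<close> presents \<open>E i\<close> as the positivity set of
  \<open>w i\<close>, and \<open>step\<close> packs the tangency and gradient conditions into one
  short move. The limit passage is what remains.\<close>

lemma differential_inclusion_core:
  fixes D :: "'a::euclidean_space set" and F :: "'a \<Rightarrow> 'a set"
  assumes lc: "locally_closed_set D"
    and "0 < c" and bound: "\<And>x v. x \<in> D \<Longrightarrow> v \<in> F x \<Longrightarrow> norm v \<le> c"
    and ne: "\<And>x. x \<in> D \<Longrightarrow> F x \<noteq> {}" and F_closed: "\<And>x. x \<in> D \<Longrightarrow> closed (F x)"
    and e: "\<And>i. e i \<le> (1 / 2) ^ i"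
    and E: "\<And>i. E i \<subseteq> D" and dense: "\<And>i. D \<subseteq> closure (E i)"
    and lsc: "\<And>i. eps_lsc_on (e i) D F (E i)"
    and w: "\<And>i. continuous_on D (w i)"
    and anti: "\<And>i j x. i \<le> j \<Longrightarrow> x \<in> D \<Longrightarrow> w j x \<le> w i x"
    and pos: "\<And>i x. x \<in> D \<Longrightarrow> x \<in> E i \<longleftrightarrow> w i x > 0"
    and step: "\<And>i x y \<eta>. x \<in> E i \<Longrightarrow> y \<in> F x \<Longrightarrow> \<eta> > 0 \<Longrightarrow>
      \<exists>s z. 0 < s \<and> s \<le> \<eta> \<and> z \<in> D \<and> norm (z - x) \<le> (c + \<eta>) * s \<and>
        norm (z - x - s *\<^sub>R y) \<le> (e i + \<eta>) * s \<and> w i z \<ge> w i x + s / 2"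
    and "x0 \<in> D"
  shows "\<exists>T>0. \<exists>x. absolutely_continuous_on_interval 0 T x \<and> x ` {0..T} \<subseteq> D \<and> x 0 = x0 \<and>
    (AE t in lebesgue_on {0..T}. \<exists>v\<in>F (x t). (x has_vector_derivative v) (at t within {0..T}))"
proof -
  obtain V C where VC: "open V" "closed C" "D = V \<inter> C"
    using lc unfolding locally_closed_set_def by blast
  obtain R where "R > 0" and R: "cball x0 R \<subseteq> V"
    using VC \<open>x0 \<in> D\<close> open_contains_cball by blast
  define K where "K = D \<inter> cball x0 R"
  \<comment> \<open>Local closedness enters here: the ball lies in the open set, so \<open>K\<close>
    is closed and bounded.\<close>
  have "K = cball x0 R \<inter> C" using R VC by (auto simp: K_def)
  then have "compact K" using VC by (simp add: compact_Int_closed)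
  define L where "L = c + 1"
  have "L > 0" using \<open>0 < c\<close> by (simp add: L_def)
  \<comment> \<open>A path of speed \<open>L\<close> travels at most \<open>R / 2\<close>; the other
    half of the radius allows for moving the start from \<open>x0\<close> to
    \<open>a i\<close>.\<close>
  define T where "T = R / (2 * L)"
  have "T > 0" and LT: "L * T = R / 2" using \<open>R > 0\<close> \<open>L > 0\<close> by (simp_all add: T_def)
  have E_mono: "E j \<subseteq> E i" if "i \<le> j" for i j
    using E anti[OF that] pos by (meson less_le_trans subset_iff)
  then have E_Suc: "E (Suc i) \<subseteq> E i" for i by simp
  obtain g :: "nat \<Rightarrow> real \<times> 'a \<Rightarrow> 'a" where
    g_const: "\<And>i. locally_constant_along L T (E i) (g i)" and
    g_near: "\<And>i p. snd p \<in> E i \<Longrightarrow> F (snd p) \<inter> cball (g i p) (e i) \<noteq> {}" and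
    g_Suc: "\<And>i p. snd p \<in> E (Suc i) \<Longrightarrow> dist (g (Suc i) p) (g i p) \<le> e i"
    using nested_selections[of D F c E e L T] bound ne E E_Suc lsc \<open>L > 0\<close> less_imp_le by metis
  have g_dist: "dist (g i p) (g k p) \<le> 2 * (1 / 2) ^ k" if "k \<le> i" "snd p \<in> E i" for i k p
    using dist_selections[of e E g, OF e E_Suc _ that] g_Suc by blast
  define r where "r i = 1 / real (Suc i)" for i
  have r: "r \<longlonglongrightarrow> 0" unfolding r_def by (rule LIMSEQ_Suc[OF lim_1_over_n])
  have r_pos: "0 < r i" "r i \<le> 1" for i by (auto simp: r_def)
  \<comment> \<open>\<open>x0\<close> may lie outside \<open>E i\<close>, so density supplies
    starting points in \<open>E i\<close> that converge to it.\<close>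
  have "\<exists>a. a \<in> E i \<and> dist a x0 < min (R / 2) (r i)" for i
    using dense[of i] \<open>x0 \<in> D\<close> r_pos[of i] \<open>R > 0\<close> closure_approachable[of x0 "E i"]
    by (meson half_gt_zero min_less_iff_conj subsetD)
  then obtain a where a: "\<And>i. a i \<in> E i" "\<And>i. dist (a i) x0 < R / 2" "\<And>i. dist (a i) x0 < r i"
    by (metis min_less_iff_conj)
  define graph where "graph i G \<longleftrightarrow> (0, a i) \<in> G \<and> G \<subseteq> {0..T} \<times> K \<and>
    (\<forall>p\<in>G. w i (snd p) > fst p / 2) \<and>
    (\<forall>p\<in>G. \<forall>q\<in>G. dist (snd p) (snd q) \<le> L * \<bar>fst p - fst q\<bar>) \<and>
    (\<forall>t\<in>{0..T}. \<exists>p\<in>G. \<bar>fst p - t\<bar> \<le> r i) \<and>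
    (\<forall>p q v \<rho>. p \<in> G \<longrightarrow> q \<in> G \<longrightarrow> fst p \<le> fst q \<longrightarrow>
       (\<forall>m\<in>G. fst p \<le> fst m \<longrightarrow> fst m < fst q \<longrightarrow> dist (g i m) v \<le> \<rho>) \<longrightarrow>
       norm (snd q - snd p - (fst q - fst p) *\<^sub>R v) \<le> (\<rho> + 2 * e i + r i) * (fst q - fst p))" for i G
  have "\<exists>G. graph i G" for i
  proof -
    have 1: "dist x0 (a i) + (c + 1) * T \<le> R"
      using a(2)[of i] LT by (simp add: L_def dist_commute)
    have 2: "a i \<in> D" using a E by blast
    obtain G where "(0, a i) \<in> G" "G \<subseteq> {0..T} \<times> (D \<inter> cball x0 R)"
      "\<And>p. p \<in> G \<Longrightarrow> w i (snd p) > fst p / 2"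
      "\<And>p q. p \<in> G \<Longrightarrow> q \<in> G \<Longrightarrow> dist (snd p) (snd q) \<le> (c + 1) * \<bar>fst p - fst q\<bar>"
      "\<And>t. t \<in> {0..T} \<Longrightarrow> \<exists>p\<in>G. \<bar>fst p - t\<bar> \<le> r i"
      "\<And>p q v \<rho>. p \<in> G \<Longrightarrow> q \<in> G \<Longrightarrow> fst p \<le> fst q \<Longrightarrow>
       (\<And>m. m \<in> G \<Longrightarrow> fst p \<le> fst m \<Longrightarrow> fst m < fst q \<Longrightarrow> dist (g i m) v \<le> \<rho>) \<Longrightarrow>
       norm (snd q - snd p - (fst q - fst p) *\<^sub>R v) \<le> (\<rho> + 2 * e i + r i) * (fst q - fst p)"
      using euler_graph[where E = "E i" and w = "w i" and g = "g i" and F = F,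
          OF \<open>compact K\<close>[unfolded K_def] less_imp_le[OF \<open>0 < c\<close>] less_imp_le[OF \<open>T > 0\<close>]
          r_pos[of i] w[of i] pos a(1)[of i] 2 1 g_near step] by blast
    then have "graph i G" unfolding graph_def K_def L_def by blast
    then show ?thesis by blast
  qed
  then obtain G where G: "\<And>i. graph i (G i)" by metis
  have G_sub: "G i \<subseteq> {0..T} \<times> K"
    and G_start: "(0, a i) \<in> G i"
    and G_w: "\<And>p. p \<in> G i \<Longrightarrow> w i (snd p) > fst p / 2"
    and G_lip: "\<And>p q. p \<in> G i \<Longrightarrow> q \<in> G i \<Longrightarrow> dist (snd p) (snd q) \<le> L * \<bar>fst p - fst q\<bar>"
    and G_mesh: "\<And>t. t \<in> {0..T} \<Longrightarrow> \<exists>p\<in>G i. \<bar>fst p - t\<bar> \<le> 1 / real (Suc i)"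
    and G_incr: "\<And>p q v \<rho>. p \<in> G i \<Longrightarrow> q \<in> G i \<Longrightarrow> fst p \<le> fst q \<Longrightarrow>
       (\<And>m. m \<in> G i \<Longrightarrow> fst p \<le> fst m \<Longrightarrow> fst m < fst q \<Longrightarrow> dist (g i m) v \<le> \<rho>) \<Longrightarrow>
       norm (snd q - snd p - (fst q - fst p) *\<^sub>R v) \<le> (\<rho> + 2 * e i + r i) * (fst q - fst p)" for i
    using G[of i] unfolding graph_def r_def by blast+
  obtain \<kappa> x where \<kappa>: "strict_mono (\<kappa> :: nat \<Rightarrow> nat)" and x_lip: "L-lipschitz_on {0..T} x"
    and x_lim: "\<And>t. t \<in> {0..T} \<Longrightarrow> \<exists>p. (\<forall>i. p i \<in> G (\<kappa> i)) \<and> p \<longlonglongrightarrow> (t, x t)"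
  proof (rule approximate_graphs_limit[of K L G T, OF compact_imp_bounded[OF \<open>compact K\<close>] less_imp_le[OF \<open>L > 0\<close>] G_sub])
    show "dist (snd p) (snd q) \<le> L * \<bar>fst p - fst q\<bar>" if "p \<in> G i" "q \<in> G i" for i p q
      using G_lip that by blast
    show "\<exists>p\<in>G i. \<bar>fst p - t\<bar> \<le> 1 / real (Suc i)" if "t \<in> {0..T}" for i t
      using G_mesh that by blast
  qed (use that in blast)
  have \<kappa>_ge: "i \<le> \<kappa> i" for i using \<kappa> by (rule seq_suble)
  have r_\<kappa>: "(\<lambda>i. r (\<kappa> i)) \<longlonglongrightarrow> 0"
    using LIMSEQ_subseq_LIMSEQ[OF r \<kappa>] by (simp add: o_def)
  have nodeK: "snd p \<in> K" "snd p \<in> D" "fst p \<in> {0..T}" if "p \<in> G i" for p i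
    using that G_sub[of i] by (auto simp: K_def)
  have nodeE: "snd p \<in> E i" if "p \<in> G i" for p i
  proof -
    have "w i (snd p) > 0" using G_w[OF that] nodeK(3)[OF that] by simp
    then show ?thesis using pos nodeK(2)[OF that] by blast
  qed
  have xK: "x t \<in> K" if t: "t \<in> {0..T}" for t
  proof -
    obtain p where p: "\<And>i. p i \<in> G (\<kappa> i)" "p \<longlonglongrightarrow> (t, x t)" using x_lim[OF t] by blast
    have "(\<lambda>i. snd (p i)) \<longlonglongrightarrow> x t" using tendsto_snd[OF p(2)] by simp
    then show ?thesis
      by (rule closed_sequentially[OF compact_imp_closed[OF \<open>compact K\<close>] nodeK(1)[OF p(1)]])
  qed
  have xD: "x t \<in> D" if "t \<in> {0..T}" for t using xK[OF that] by (simp add: K_def)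
  have x_start: "x 0 = x0"
  proof -
    obtain p where p: "\<And>i. p i \<in> G (\<kappa> i)" "p \<longlonglongrightarrow> (0, x 0)" using x_lim[of 0] \<open>T > 0\<close> by auto
    have p1: "(\<lambda>i. fst (p i)) \<longlonglongrightarrow> 0" and p2: "(\<lambda>i. snd (p i)) \<longlonglongrightarrow> x 0"
      using tendsto_fst[OF p(2)] tendsto_snd[OF p(2)] by simp_all
    have "dist (snd (p i)) x0 \<le> L * \<bar>fst (p i)\<bar> + r (\<kappa> i)" for i
      using dist_triangle[of "snd (p i)" x0 "a (\<kappa> i)"] G_lip[OF p(1)[of i] G_start] a(3)[of "\<kappa> i"] by simp
    moreover have "(\<lambda>i. L * \<bar>fst (p i)\<bar> + r (\<kappa> i)) \<longlonglongrightarrow> L * \<bar>0\<bar> + 0"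
      by (intro tendsto_intros p1 r_\<kappa>)
    moreover have "(\<lambda>i. dist (snd (p i)) x0) \<longlonglongrightarrow> dist (x 0) x0"
      by (intro tendsto_intros p2)
    ultimately have "dist (x 0) x0 \<le> L * \<bar>0\<bar> + 0" by (intro LIMSEQ_le[of "\<lambda>i. dist (snd (p i)) x0"]) auto
    then show ?thesis by simp
  qed
  have xE: "x t \<in> E k" if t: "t \<in> {0<..T}" for t k
  proof -
    have t': "t \<in> {0..T}" using t by simp
    obtain p where p: "\<And>i. p i \<in> G (\<kappa> i)" "p \<longlonglongrightarrow> (t, x t)" using x_lim[OF t'] by blast
    have p1: "(\<lambda>i. fst (p i)) \<longlonglongrightarrow> t" and p2: "(\<lambda>i. snd (p i)) \<longlonglongrightarrow> x t"
      using tendsto_fst[OF p(2)] tendsto_snd[OF p(2)] by simp_all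
    have "(\<lambda>i. w k (snd (p i))) \<longlonglongrightarrow> w k (x t)"
      by (rule continuous_on_tendsto_compose[OF w p2 xD[OF t']]) (simp add: nodeK(2)[OF p(1)])
    moreover have "(\<lambda>i. fst (p i) / 2) \<longlonglongrightarrow> t / 2" by (intro tendsto_intros p1) simp
    \<comment> \<open>Later approximations control \<open>w k\<close> as well, since
      \<open>w\<close> decreases in its index; thus one limit path obeys the bounds for all
      \<open>k\<close>.\<close>
    moreover have "fst (p i) / 2 \<le> w k (snd (p i))" if "i \<ge> k" for i
    proof -
      have "w (\<kappa> i) (snd (p i)) \<le> w k (snd (p i))"
        using anti[of k "\<kappa> i"] \<kappa>_ge[of i] that nodeK(2)[OF p(1)] by simp
      then show ?thesis using G_w[OF p(1)[of i]] by linarith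
    qed
    ultimately have "t / 2 \<le> w k (x t)" by (intro LIMSEQ_le[of "\<lambda>i. fst (p i) / 2"]) auto
    then show ?thesis using pos xD[OF t'] t by force
  qed
  \<comment> \<open>Countable by \<open>g_const\<close>, because \<open>xE\<close> places the
    Lipschitz path in every \<open>E k\<close> at positive times.\<close>
  define N where "N = (\<Union>k. {t\<in>{0<..T}. \<not> (\<forall>\<^sub>F p in nhds (t, x t). g k p = g k (t, x t))})"
  have "countable {t\<in>{0<..T}. \<not> (\<forall>\<^sub>F p in nhds (t, x t). g k p = g k (t, x t))}" for k
    using g_const[of k] x_lip xE unfolding locally_constant_along_def by blast
  then have "countable N" unfolding N_def by blast
  have deriv: "\<exists>v\<in>F (x t). (x has_vector_derivative v) (at t within {0..T})"
    if t: "0 < t" "t < T" "t \<notin> N" for t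
  proof -
    have tI: "t \<in> {0..T}" "t \<in> {0<..T}" using t by auto
    define v where "v k = g k (t, x t)" for k
    have v_dist: "dist (v i) (v k) \<le> 2 * (1 / 2) ^ k" if "k \<le> i" for i k
      unfolding v_def using g_dist[OF that, of "(t, x t)"] xE[OF tI(2)] by simp
    have half: "(\<lambda>k. (1 / 2 :: real) ^ k) \<longlonglongrightarrow> 0" by (rule LIMSEQ_realpow_zero) auto
    have "Cauchy v"
    proof (rule metric_CauchyI)
      fix \<epsilon> :: real assume "\<epsilon> > 0"
      \<comment> \<open>Both \<open>v m\<close> and \<open>v n\<close> are within
        \<open>2 * (1 / 2) ^ k\<close> of \<open>v k\<close>, hence the divisor 4.\<close>
      then obtain k where k: "(1 / 2) ^ k < \<epsilon> / 4"
        using real_arch_pow_inv[of "\<epsilon> / 4" "1 / 2"] by auto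
      show "\<exists>M. \<forall>m\<ge>M. \<forall>n\<ge>M. dist (v m) (v n) < \<epsilon>"
      proof (intro exI allI impI)
        fix m n assume "k \<le> m" "k \<le> n"
        then show "dist (v m) (v n) < \<epsilon>"
          using v_dist[of k m] v_dist[of k n] dist_triangle2[of "v m" "v n" "v k"] k by linarith
      qed
    qed
    then obtain v' where v': "v \<longlonglongrightarrow> v'" using Cauchy_convergent_iff convergent_def by blast
    have "v' \<in> F (x t)"
    proof -
      have "\<exists>y. y \<in> F (x t) \<and> dist (v k) y \<le> (1 / 2) ^ k" for k
        using g_near[of "(t, x t)" k] xE[OF tI(2)] e[of k] unfolding v_def by force
      then obtain y where y: "\<And>k. y k \<in> F (x t)" "\<And>k. dist (v k) (y k) \<le> (1 / 2) ^ k" by metis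
      have "(\<lambda>k. y k - v k) \<longlonglongrightarrow> 0"
        by (rule Lim_null_comparison[OF _ half]) (use y(2) in \<open>auto simp: dist_norm norm_minus_commute\<close>)
      from tendsto_add[OF this v'] have "y \<longlonglongrightarrow> v'" by simp
      then show ?thesis by (rule closed_sequentially[OF F_closed[OF xD[OF tI(1)]] y(1)])
    qed
    \<comment> \<open>The factor 4 consists of 2 for passing from level \<open>\<kappa> i\<close> to
      level \<open>k\<close> and 2 for the Euler error \<open>2 * e (\<kappa> i)\<close>; the mesh
      term \<open>r (\<kappa> i)\<close> vanishes in the limit.\<close>
    moreover have "(x has_vector_derivative v') (at t within {0..T})"
    proof (rule has_vector_derivative_from_estimates[of _ _ _ v "\<lambda>k. 4 * (1 / 2) ^ k"])
      show "(\<lambda>k. 4 * (1 / 2 :: real) ^ k) \<longlonglongrightarrow> 0" using tendsto_mult_left[OF half, of 4] by simp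
      fix k
      have "\<forall>\<^sub>F p in nhds (t, x t). g k p = v k"
        using \<open>t \<notin> N\<close> tI unfolding N_def v_def by blast
      then obtain d where "d > 0" and d: "\<And>p. dist p (t, x t) < d \<Longrightarrow> g k p = v k"
        unfolding eventually_nhds_metric by blast
      \<comment> \<open>Nodes at times within \<open>\<eta>\<close> of \<open>t\<close> will be at
        distance below \<open>\<eta>\<close> in time and \<open>2 * L * \<eta> + \<eta>\<close> in
        space from \<open>(t, x t)\<close>, which adds up to \<open>d\<close>.\<close>
      define \<eta> where "\<eta> = d / (2 * (L + 1))"
      have "\<eta> > 0" using \<open>d > 0\<close> \<open>L > 0\<close> by (simp add: \<eta>_def)
      have \<eta>: "2 * (L + 1) * \<eta> = d" using \<open>L > 0\<close> by (simp add: \<eta>_def)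
      obtain p where p: "\<And>i. p i \<in> G (\<kappa> i)" "p \<longlonglongrightarrow> (t, x t)" using x_lim[OF tI(1)] by blast
      have est: "norm (x b - x a - (b - a) *\<^sub>R v k) \<le> 4 * (1 / 2) ^ k * (b - a)"
        if ab: "a \<in> {0..T}" "b \<in> {0..T}" "a < b" "\<bar>a - t\<bar> < \<eta>" "\<bar>b - t\<bar> < \<eta>" for a b
      proof -
        obtain pa where pa: "\<And>i. pa i \<in> G (\<kappa> i)" "pa \<longlonglongrightarrow> (a, x a)" using x_lim[OF ab(1)] by blast
        obtain pb where pb: "\<And>i. pb i \<in> G (\<kappa> i)" "pb \<longlonglongrightarrow> (b, x b)" using x_lim[OF ab(2)] by blast
        have a1: "(\<lambda>i. fst (pa i)) \<longlonglongrightarrow> a" and a2: "(\<lambda>i. snd (pa i)) \<longlonglongrightarrow> x a"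
          using tendsto_fst[OF pa(2)] tendsto_snd[OF pa(2)] by simp_all
        have b1: "(\<lambda>i. fst (pb i)) \<longlonglongrightarrow> b" and b2: "(\<lambda>i. snd (pb i)) \<longlonglongrightarrow> x b"
          using tendsto_fst[OF pb(2)] tendsto_snd[OF pb(2)] by simp_all
        have "\<forall>\<^sub>F i in sequentially. t - \<eta> < fst (pa i)"
          by (rule order_tendstoD(1)[OF a1]) (use ab in auto)
        moreover have "\<forall>\<^sub>F i in sequentially. fst (pb i) < t + \<eta>"
          by (rule order_tendstoD(2)[OF b1]) (use ab in auto)
        \<comment> \<open>The midpoint separates the two limit times, so eventually the nodes are in
          the right order.\<close>
        moreover have "\<forall>\<^sub>F i in sequentially. fst (pa i) < (a + b) / 2"
          by (rule order_tendstoD(2)[OF a1]) (use ab in auto)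
        moreover have "\<forall>\<^sub>F i in sequentially. (a + b) / 2 < fst (pb i)"
          by (rule order_tendstoD(1)[OF b1]) (use ab in auto)
        moreover have "\<forall>\<^sub>F i in sequentially. dist (p i) (t, x t) < \<eta>"
          by (rule tendstoD[OF p(2) \<open>\<eta> > 0\<close>])
        moreover have "\<forall>\<^sub>F i in sequentially. k \<le> i" by (rule eventually_ge_at_top)
        ultimately have "\<forall>\<^sub>F i in sequentially.
          norm (snd (pb i) - snd (pa i) - (fst (pb i) - fst (pa i)) *\<^sub>R v k)
            \<le> (4 * (1 / 2) ^ k + r (\<kappa> i)) * (fst (pb i) - fst (pa i))"
        proof eventually_elim
          case (elim i)
          have "k \<le> \<kappa> i" using \<kappa>_ge[of i] elim by simp
          have "dist (g (\<kappa> i) m) (v k) \<le> 2 * (1 / 2) ^ k"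
            if m: "m \<in> G (\<kappa> i)" "fst (pa i) \<le> fst m" "fst m < fst (pb i)" for m
          proof -
            have mt: "\<bar>fst m - t\<bar> < \<eta>" using elim m by auto
            have "dist (fst (p i)) t < \<eta>" "dist (snd (p i)) (x t) < \<eta>"
              using dist_fst_le[of "p i" "(t, x t)"] dist_snd_le[of "p i" "(t, x t)"] elim by auto
            moreover from this mt have "\<bar>fst m - fst (p i)\<bar> \<le> 2 * \<eta>" by (simp add: dist_real_def)
            then have "L * \<bar>fst m - fst (p i)\<bar> \<le> L * (2 * \<eta>)"
              using \<open>L > 0\<close> by (intro mult_left_mono) auto
            moreover have "dist (snd m) (snd (p i)) \<le> L * \<bar>fst m - fst (p i)\<bar>"
              by (rule G_lip[OF m(1) p(1)])
            ultimately have "dist (snd m) (x t) < 2 * L * \<eta> + \<eta>"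
              using dist_triangle[of "snd m" "x t" "snd (p i)"] by simp
            then have "dist m (t, x t) < d"
              using dist_prod_le[of m "(t, x t)"] mt \<eta> by (simp add: dist_real_def algebra_simps)
            \<comment> \<open>The neighbourhood of constancy belongs to the fixed level
              \<open>k\<close> and is the same for all \<open>i\<close>; \<open>g_dist\<close>
              carries the value over to level \<open>\<kappa> i\<close>, as the node lies in
              \<open>E (\<kappa> i)\<close>.\<close>
            then have "g k m = v k" by (rule d)
            then show ?thesis
              using g_dist[OF \<open>k \<le> \<kappa> i\<close> nodeE[OF m(1)]] by simp
          qed
          then have "norm (snd (pb i) - snd (pa i) - (fst (pb i) - fst (pa i)) *\<^sub>R v k)
            \<le> (2 * (1 / 2) ^ k + 2 * e (\<kappa> i) + r (\<kappa> i)) * (fst (pb i) - fst (pa i))"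
            using elim by (intro G_incr pa pb) auto
          also have "\<dots> \<le> (4 * (1 / 2) ^ k + r (\<kappa> i)) * (fst (pb i) - fst (pa i))"
          proof (rule mult_right_mono)
            have "(1 / 2 :: real) ^ \<kappa> i \<le> (1 / 2) ^ k"
              using \<open>k \<le> \<kappa> i\<close> by (intro power_decreasing) auto
            then show "2 * (1 / 2) ^ k + 2 * e (\<kappa> i) + r (\<kappa> i) \<le> 4 * (1 / 2) ^ k + r (\<kappa> i)"
              using e[of "\<kappa> i"] by linarith
          qed (use elim in auto)
          finally show ?case .
        qed
        moreover have "(\<lambda>i. norm (snd (pb i) - snd (pa i) - (fst (pb i) - fst (pa i)) *\<^sub>R v k))
            \<longlonglongrightarrow> norm (x b - x a - (b - a) *\<^sub>R v k)"
          by (intro tendsto_intros a1 a2 b1 b2)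
        moreover have "(\<lambda>i. (4 * (1 / 2) ^ k + r (\<kappa> i)) * (fst (pb i) - fst (pa i)))
            \<longlonglongrightarrow> (4 * (1 / 2) ^ k + 0) * (b - a)"
          by (intro tendsto_intros a1 b1 r_\<kappa>)
        ultimately have "norm (x b - x a - (b - a) *\<^sub>R v k) \<le> (4 * (1 / 2) ^ k + 0) * (b - a)"
          by (intro tendsto_le[OF sequentially_bot])
        then show ?thesis by simp
      qed
      then show "\<exists>\<eta>>0. \<forall>a\<in>{0..T}. \<forall>b\<in>{0..T}. a < b \<longrightarrow> \<bar>a - t\<bar> < \<eta> \<longrightarrow> \<bar>b - t\<bar> < \<eta> \<longrightarrow>
          norm (x b - x a - (b - a) *\<^sub>R v k) \<le> 4 * (1 / 2) ^ k * (b - a)"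
        using \<open>\<eta> > 0\<close> by blast
    qed (use tI v' in auto)
    ultimately show ?thesis by blast
  qed
  show ?thesis
  proof (intro exI conjI)
    show "T > 0" by fact
    show "absolutely_continuous_on_interval 0 T x"
      by (rule lipschitz_on_imp_absolutely_continuous[OF x_lip])
    show "x ` {0..T} \<subseteq> D" using xD by blast
    show "x 0 = x0" by (rule x_start)
    show "AE t in lebesgue_on {0..T}. \<exists>v\<in>F (x t). (x has_vector_derivative v) (at t within {0..T})"
      by (rule AE_lebesgue_on_interval[OF \<open>countable N\<close> deriv])
  qed
qed

section \<open>Tangent directions, gradients and the reduction to the core\<close>

text \<open>Expand \<open>W\<close> to first order along the sequence defining the tangent vector.
  The slope is at least 1; the remainder and the deviation of the direction from \<open>v\<close>
  cost at most 1/4 each, which leaves 1/2.\<close>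

lemma tangent_step:
  fixes x v d :: "'a::euclidean_space"
  assumes v: "v \<in> bouligand_cone D x" and d: "d \<bullet> v \<ge> 1" and W: "GDERIV W x :> d"
    and E: "openin (top_of_set D) E" "x \<in> E" "\<And>z. z \<in> E \<Longrightarrow> W z = w z" and "\<eta> > 0"
  obtains s z where "0 < s" "s \<le> \<eta>" "z \<in> D" "norm (z - x - s *\<^sub>R v) \<le> \<eta> * s" "w z \<ge> w x + s / 2"
proof -
  obtain u t where u: "\<And>n. u n \<in> D" "u \<longlonglongrightarrow> x" and t: "\<And>n. t n > 0" "t \<longlonglongrightarrow> 0"
    and q: "(\<lambda>n. (u n - x) /\<^sub>R t n) \<longlonglongrightarrow> v"
    using v unfolding bouligand_cone_def by blast
  \<comment> \<open>Makes the remainder \<open>e * norm (z - x)\<close> at most \<open>s / 4\<close>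
    once \<open>norm (z - x) \<le> s * (norm v + 1)\<close>.\<close>
  define e where "e = 1 / (4 * (norm v + 1))"
  have "e > 0" by (simp add: e_def add_nonneg_pos)
  \<comment> \<open>The entry 1 yields that bound on \<open>norm (z - x)\<close>; the last entry
    makes the direction error cost at most 1/4 against \<open>d\<close>.\<close>
  define \<rho> where "\<rho> = Min {\<eta>, 1, 1 / (4 * (norm d + 1))}"
  have "\<rho> > 0" using \<open>\<eta> > 0\<close> by (auto simp: \<rho>_def add_nonneg_pos)
  have \<rho>: "\<rho> \<le> \<eta>" "\<rho> \<le> 1" "\<rho> \<le> 1 / (4 * (norm d + 1))" by (auto simp: \<rho>_def)
  obtain \<delta> where "\<delta> > 0" and \<delta>: "\<And>y. norm (y - x) < \<delta> \<Longrightarrow> norm (W y - W x - (y - x) \<bullet> d) \<le> e * norm (y - x)"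
    using W \<open>e > 0\<close> unfolding gderiv_def has_derivative_at_alt by meson
  \<comment> \<open>\<open>W\<close> is tied to \<open>w\<close> on \<open>E\<close> only; relative
    openness puts \<open>u n\<close> into \<open>E\<close> eventually.\<close>
  obtain V where V: "open V" "E = D \<inter> V" using E(1) by (auto simp: openin_open)
  have "\<forall>\<^sub>F n in sequentially. u n \<in> V"
    using u(2) V E(2) by (auto intro: topological_tendstoD)
  moreover have "\<forall>\<^sub>F n in sequentially. dist (u n) x < \<delta>"
    using u(2) \<open>\<delta> > 0\<close> by (rule tendstoD)
  moreover have "\<forall>\<^sub>F n in sequentially. dist ((u n - x) /\<^sub>R t n) v < \<rho>"
    using q \<open>\<rho> > 0\<close> by (rule tendstoD)
  moreover have "\<forall>\<^sub>F n in sequentially. t n < \<eta>"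
    using t(2) \<open>\<eta> > 0\<close> by (rule order_tendstoD(2))
  ultimately have "\<forall>\<^sub>F n in sequentially. u n \<in> V \<and> dist (u n) x < \<delta> \<and> dist ((u n - x) /\<^sub>R t n) v < \<rho> \<and> t n < \<eta>"
    by eventually_elim blast
  then obtain n where n: "u n \<in> V" "dist (u n) x < \<delta>" "dist ((u n - x) /\<^sub>R t n) v < \<rho>" "t n < \<eta>"
    using eventually_happens by force
  define s where "s = t n"
  define z where "z = u n"
  define p where "p = (z - x) /\<^sub>R s - v"
  have "s > 0" using t by (simp add: s_def)
  have zx: "z - x = s *\<^sub>R (v + p)" using \<open>s > 0\<close> by (simp add: p_def)
  have np: "norm p < \<rho>" using n(3) by (simp add: p_def s_def z_def dist_norm)
  have "z \<in> E" using V n u by (auto simp: z_def)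
  have "norm (z - x - s *\<^sub>R v) = s * norm p" using \<open>s > 0\<close> by (simp add: zx algebra_simps)
  also have "\<dots> \<le> \<eta> * s" using np \<rho> \<open>s > 0\<close> by simp
  finally have 1: "norm (z - x - s *\<^sub>R v) \<le> \<eta> * s" .
  have "norm (z - x) = s * norm (v + p)" using \<open>s > 0\<close> by (simp add: zx)
  also have "\<dots> \<le> s * (norm v + 1)"
    using np \<rho> \<open>s > 0\<close> norm_triangle_ineq[of v p] by (intro mult_left_mono) auto
  finally have "e * norm (z - x) \<le> e * (s * (norm v + 1))"
    using \<open>e > 0\<close> by (intro mult_left_mono) auto
  also have "\<dots> = s / 4" by (simp add: e_def field_simps add_nonneg_eq_0_iff)
  finally have 2: "e * norm (z - x) \<le> s / 4" .
  have "\<bar>p \<bullet> d\<bar> \<le> norm p * norm d" by (rule Cauchy_Schwarz_ineq2)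
  also have "\<dots> \<le> 1 / (4 * (norm d + 1)) * norm d" using np \<rho> by (intro mult_right_mono) auto
  also have "\<dots> \<le> 1 / 4" by (simp add: divide_simps add_nonneg_eq_0_iff add_nonneg_nonneg not_less)
  finally have "v \<bullet> d + p \<bullet> d \<ge> 3 / 4" using d by (simp add: inner_commute)
  then have "s * (v \<bullet> d + p \<bullet> d) \<ge> s * (3 / 4)" using \<open>s > 0\<close> by (intro mult_left_mono) auto
  then have 3: "(z - x) \<bullet> d \<ge> s * 3 / 4" by (simp add: zx inner_add_left)
  have "norm (W z - W x - (z - x) \<bullet> d) \<le> e * norm (z - x)"
    using \<delta> n(2) by (simp add: z_def dist_norm)
  then have "W z \<ge> W x + s / 2" using 2 3 by (simp add: abs_le_iff)
  then have "w z \<ge> w x + s / 2" using E \<open>z \<in> E\<close> by simp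
  moreover have "s \<le> \<eta>" "z \<in> D" using n(4) u(1) by (auto simp: s_def z_def)
  ultimately show thesis using that[OF \<open>s > 0\<close>] 1 by blast
qed

text \<open>As \<open>grad\<close> is a definite description, existence and uniqueness both have to
  be shown: the Riesz vector of the derivative is written in coordinates, and derivatives are
  unique.\<close>

lemma differentiable_imp_GDERIV_grad:
  fixes f :: "'a::euclidean_space \<Rightarrow> real"
  assumes "f differentiable (at x)"
  shows "GDERIV f x :> grad f x"
proof -
  obtain f' where f': "(f has_derivative f') (at x)"
    using assms by (auto simp: differentiable_def)
  then interpret bounded_linear f' by (rule has_derivative_bounded_linear)
  define d where "d = (\<Sum>b\<in>Basis. f' b *\<^sub>R b)"
  have "f' = (\<lambda>h. h \<bullet> d)"
  proof
    fix h
    have "f' h = f' (\<Sum>b\<in>Basis. (h \<bullet> b) *\<^sub>R b)" by (simp add: euclidean_representation)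
    also have "\<dots> = h \<bullet> d" by (simp add: sum scaleR d_def inner_sum_right mult.commute)
    finally show "f' h = h \<bullet> d" .
  qed
  with f' have d: "GDERIV f x :> d" by (simp add: gderiv_def)
  have "d' = d" if "GDERIV f x :> d'" for d'
  proof -
    have "(\<lambda>h. h \<bullet> d') = (\<lambda>h. h \<bullet> d)"
      using that d unfolding gderiv_def by (rule has_derivative_unique)
    then have "\<forall>h. h \<bullet> d' = h \<bullet> d" by meson
    then show ?thesis by (simp only: vector_eq_ldot)
  qed
  with d show ?thesis unfolding grad_def by (rule theI)
qed

lemma smooth_on_differentiable:
  assumes "smooth_on U f" "x \<in> U"
  shows "f differentiable (at x)"
  using assms unfolding smooth_on_def by (metis Cm_on.simps(2))

lemma Fk_subset: "Fk F W k x \<subseteq> F x"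
  by (induction k) auto

theorem corollary3p4:
  fixes D :: "(real ^ 'n) set"
    and F :: "real ^ 'n \<Rightarrow> (real ^ 'n) set"
    and \<epsilon> :: "nat \<Rightarrow> real"
    and Dk :: "nat \<Rightarrow> (real ^ 'n) set"
    and w :: "nat \<Rightarrow> real ^ 'n \<Rightarrow> real"
    and U :: "nat \<Rightarrow> (real ^ 'n) set"
    and W :: "nat \<Rightarrow> real ^ 'n \<Rightarrow> real"
  assumes "locally_closed_set D"
    and "\<exists>c>0. \<forall>x\<in>closure D. \<forall>v\<in>F x. norm v \<le> c"
    and "\<forall>x\<in>closure D. F x \<noteq> {} \<and> closed (F x)"
    and "\<forall>k\<ge>1. \<epsilon> k > 0"
    and "\<epsilon> \<longlonglongrightarrow> 0"
    and "\<forall>k\<ge>1. openin (top_of_set D) (Dk k) \<and> D \<subseteq> closure (Dk k)"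
    and "Dk 1 = D"
    and "\<forall>k\<ge>1. eps_lsc_on (\<epsilon> k) D F (Dk k)"
    and "\<forall>k\<ge>1. continuous_on D (w k)"
    and "\<forall>k1\<ge>1. \<forall>k2\<ge>k1. \<forall>x\<in>D. w k1 x \<ge> w k2 x"
    and "\<forall>k\<ge>1. \<forall>x\<in>D. w k x \<ge> 0 \<and> (w k x = 0 \<longleftrightarrow> x \<notin> Dk k)"
    and "\<forall>k\<ge>1. open (U k) \<and> Dk k \<subseteq> U k \<and> smooth_on (U k) (W k) \<and> (\<forall>x\<in>Dk k. W k x = w k x)"
    and "\<forall>k\<ge>1. \<forall>x\<in>Dk k. Fk F W k x \<noteq> {}"
    and "\<forall>k\<ge>1. \<forall>x\<in>Dk k. F x \<subseteq> (bouligand_cone D x \<inter> Fk F W k x) + cball 0 (\<epsilon> k)"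
  shows "\<forall>x0\<in>D. \<exists>T>0. \<exists>x :: real \<Rightarrow> real ^ 'n.
           absolutely_continuous_on_interval 0 T x \<and>
           x ` {0..T} \<subseteq> D \<and>
           x 0 = x0 \<and>
           (AE t in lebesgue_on {0..T}.
              \<exists>v\<in>F (x t). (x has_vector_derivative v) (at t within {0..T}))"
proof
  fix x0 assume "x0 \<in> D"
  obtain c where "c > 0" and c: "\<And>x v. x \<in> closure D \<Longrightarrow> v \<in> F x \<Longrightarrow> norm v \<le> c"
    using assms(2) by blast
  have "\<exists>N. \<forall>n\<ge>N. \<epsilon> n < (1 / 2) ^ i" for i
    using order_tendstoD(2)[OF \<open>\<epsilon> \<longlonglongrightarrow> 0\<close>, of "(1 / 2) ^ i"] by (auto simp: eventually_sequentially)
  then obtain N where N: "\<And>i n. n \<ge> N i \<Longrightarrow> \<epsilon> n < (1 / 2) ^ i" by metis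
  \<comment> \<open>Partial sums make the index monotone and at least \<open>N i\<close>;
    \<open>Suc\<close> keeps it at least 1, where the hypotheses start, and lets \<open>Fk\<close>
    unfold to its gradient condition.\<close>
  define \<kappa> where "\<kappa> i = Suc (\<Sum>j\<le>i. N j)" for i
  have "1 \<le> \<kappa> i" for i by (simp add: \<kappa>_def)
  have "N i \<le> \<kappa> i" for i
    using member_le_sum[of i "{..i}" N] by (simp add: \<kappa>_def)
  have \<kappa>_mono: "\<kappa> i \<le> \<kappa> j" if "i \<le> j" for i j
    unfolding \<kappa>_def using that by (auto intro!: sum_mono2)
  have Dk_sub: "Dk k \<subseteq> D" if "k \<ge> 1" for k
    using assms(6) that openin_imp_subset by blast
  show "\<exists>T>0. \<exists>x. absolutely_continuous_on_interval 0 T x \<and> x ` {0..T} \<subseteq> D \<and> x 0 = x0 \<and>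
    (AE t in lebesgue_on {0..T}. \<exists>v\<in>F (x t). (x has_vector_derivative v) (at t within {0..T}))"
  proof (rule differential_inclusion_core[where c = c and e = "\<lambda>i. \<epsilon> (\<kappa> i)" and
        E = "\<lambda>i. Dk (\<kappa> i)" and w = "\<lambda>i. w (\<kappa> i)"])
    show "locally_closed_set D" "c > 0" "x0 \<in> D" by fact+
    have "D \<subseteq> closure D" by (rule closure_subset)
    then show "norm v \<le> c" if "x \<in> D" "v \<in> F x" for x v using c that by blast
    show "F x \<noteq> {}" "closed (F x)" if "x \<in> D" for x
      using assms(3) \<open>D \<subseteq> closure D\<close> that by blast+
    fix i
    let ?k = "\<kappa> i"
    show "\<epsilon> ?k \<le> (1 / 2) ^ i" using N[OF \<open>N i \<le> \<kappa> i\<close>] by simp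
    show "Dk ?k \<subseteq> D" "D \<subseteq> closure (Dk ?k)" "eps_lsc_on (\<epsilon> ?k) D F (Dk ?k)" "continuous_on D (w ?k)"
      using Dk_sub assms(6,8,9) \<open>1 \<le> ?k\<close> by blast+
    show "w (\<kappa> j) x \<le> w ?k x" if "i \<le> j" "x \<in> D" for j x
      using assms(10) \<open>1 \<le> ?k\<close> \<kappa>_mono[OF that(1)] that(2) by blast
    show "x \<in> Dk ?k \<longleftrightarrow> w ?k x > 0" if "x \<in> D" for x
      using assms(11) \<open>1 \<le> ?k\<close> that by (metis less_le)
    fix x y and \<eta> :: real
    assume x: "x \<in> Dk ?k" and y: "y \<in> F x" and "\<eta> > 0"
    have "y \<in> (bouligand_cone D x \<inter> Fk F W ?k x) + cball 0 (\<epsilon> ?k)"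
      using assms(14) \<open>1 \<le> ?k\<close> x y by blast
    \<comment> \<open>The move follows \<open>v\<close>, which is tangent and has gradient slope at
      least 1, in place of \<open>y\<close>; the replacement costs \<open>b\<close>, hence the error
      \<open>\<epsilon> ?k\<close>.\<close>
    then obtain v b where v: "v \<in> bouligand_cone D x" "v \<in> Fk F W ?k x"
      and b: "norm b \<le> \<epsilon> ?k" and yvb: "y = v + b"
      by (auto elim!: set_plus_elim)
    have "norm v \<le> c"
      using v(2) Fk_subset[of F W ?k x] c[of x v] Dk_sub[OF \<open>1 \<le> ?k\<close>] x \<open>D \<subseteq> closure D\<close> by blast
    obtain k' where "?k = Suc k'" by (simp add: \<kappa>_def)
    then have grad_v: "grad (W ?k) x \<bullet> v \<ge> 1" using v(2) by simp
    have U: "Dk ?k \<subseteq> U ?k" "smooth_on (U ?k) (W ?k)" "\<And>z. z \<in> Dk ?k \<Longrightarrow> W ?k z = w ?k z"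
      using assms(12) \<open>1 \<le> ?k\<close> by blast+
    have "GDERIV (W ?k) x :> grad (W ?k) x"
      using U(1) x by (intro differentiable_imp_GDERIV_grad smooth_on_differentiable[OF U(2)]) blast
    moreover have "openin (top_of_set D) (Dk ?k)" using assms(6) \<open>1 \<le> ?k\<close> by blast
    ultimately obtain s z where s: "0 < s" "s \<le> \<eta>" "z \<in> D" "norm (z - x - s *\<^sub>R v) \<le> \<eta> * s"
      "w ?k z \<ge> w ?k x + s / 2"
      using tangent_step[where W = "W ?k" and w = "w ?k", OF v(1) grad_v _ _ x U(3) \<open>\<eta> > 0\<close>] by blast
    have "norm (z - x) \<le> norm (z - x - s *\<^sub>R v) + norm (s *\<^sub>R v)"
      using norm_triangle_ineq[of "z - x - s *\<^sub>R v" "s *\<^sub>R v"] by simp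
    also have "norm (s *\<^sub>R v) \<le> c * s" using \<open>norm v \<le> c\<close> s(1) by simp
    finally have 1: "norm (z - x) \<le> (c + \<eta>) * s" using s(4) by (simp add: algebra_simps)
    have "norm (z - x - s *\<^sub>R y) \<le> norm (z - x - s *\<^sub>R v) + norm (s *\<^sub>R b)"
      using norm_triangle_ineq4[of "z - x - s *\<^sub>R v" "s *\<^sub>R b"] by (simp add: yvb algebra_simps)
    also have "norm (s *\<^sub>R b) \<le> \<epsilon> ?k * s" using b s(1) by simp
    finally have 2: "norm (z - x - s *\<^sub>R y) \<le> (\<epsilon> ?k + \<eta>) * s" using s(4) by (simp add: algebra_simps)
    show "\<exists>s z. 0 < s \<and> s \<le> \<eta> \<and> z \<in> D \<and> norm (z - x) \<le> (c + \<eta>) * s \<and>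
      norm (z - x - s *\<^sub>R y) \<le> (\<epsilon> ?k + \<eta>) * s \<and> w ?k z \<ge> w ?k x + s / 2"
      using s 1 2 by blast
  qed
qed

end
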